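(* Let $X_{\mathrm{Trib}}$ be the two-sided Tribonacci subshift over $\mathcal{A}_3=\{1,2,3\}$, let $\nu$ be its unique shift-invariant probability measure, and let $f:\mathcal{A}_3\to\mathbb{R}$ be non-constant. Then $\sigma_{\mathrm{pp}}(H_x)=\emptyset$ for $\nu$-almost every $x\in X_{\mathrm{Trib}}$.
   Context: The Tribonacci subshift $X_{\mathrm{Trib}}$ is the two-sided Arnoux-Rauzy subshift over $\mathcal{A}_3$ with index sequence $(i_n)=1,2,3,1,2,3,1,2,3,\dots$ (the index sequence determines the subshift), defined as follows. $\mathbb{N}=\{1,2,\dots\}$, $k=3$. For $x\in\mathcal{A}_k^{\mathbb{N}}$ or $\mathcal{A}_k^{\mathbb{Z}}$, $F_x(n)$ is the set of factors (contiguous subwords) of $x$ of length $n$, and $F_x=\bigcup_n F_x(n)$. A factor $u$ is right-special if there are letters $a\ne b$ with $ua,ub\in F_x$; left-special if there are $a\neq b$ with $au,bu\in F_x$; bispecial if both. The empty word $\varepsilon$ is counted as a bispecial factor. The sequence $x$ is an Arnoux-Rauzy (AR) sequence if (1) $x$ is uniformly recurrent (each factor occurs with bounded gaps), (2) $|F_x(n)|=(k-1)n+1$ for all $n\in\mathbb{N}$, and (3) for each $n$, $F_x(n)$ contains exactly one right-special factor and exactly one left-special factor. The associated two-sided AR subshift is $X=\{y\in\mathcal{A}_k^{\mathbb{Z}} : F_y(n)=F_x(n)\ \forall n\in\mathbb{N}\}$; it is known to be uniquely ergodic. Index sequence: let $\varepsilon=w_1,w_2,w_3,\dots$ be the bispecial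 factors ordered so that $0=|w_1|<|w_2|<\cdots$; then $i_n\in\mathcal{A}_k$ is the unique letter such that $i_nw_n$ is right-special. Equivalently (by a theorem of Risley and Zamboni), $X_{\mathrm{Trib}}$ consists of all two-sided sequences with the same factors as the fixed point, starting with $1$, of the substitution $S(1)=1213121$, $S(2)=121312$, $S(3)=1213$. For $x\in X_{\mathrm{Trib}}$, $H_x$ is the bounded self-adjoint operator on $\mathcal{H}=\ell^2(\mathbb{Z})$ given by $(H_x\phi)(n)=\phi(n+1)+\phi(n-1)+V_x(n)\phi(n)$ with $V_x(n)=f(x_n)$. For $\phi\in\mathcal{H}$, the spectral measure $\mu_\phi$ is defined by $\langle\phi,(H_x-z)^{-1}\phi\rangle=\int_{\mathbb{R}}\frac{d\mu_\phi(t)}{t-z}$ for all $z$ with $\mathrm{Im}\,z>0$; $\mathcal{H}_{\mathrm{pp}}=\{\phi\in\mathcal{H}:\mu_\phi\text{ is pure point}\}$ and $\sigma_{\mathrm{pp}}(H_x)=\sigma(H_x|_{\mathcal{H}_{\mathrm{pp}}})$. *)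

theory Defs
  imports "HOL-Probability.Probability"
begin

section \<open>Arnoux-Rauzy subshifts\<close>

definition alphabet :: "nat \<Rightarrow> nat set" where
  "alphabet k = {1..k}"

text \<open>
  Sequences are functions on an index type \<open>'i\<close>, which is \<open>nat\<close> for one-sided and \<open>int\<close> for
  two-sided sequences. One-sided sequences are indexed from \<open>0\<close> rather than from \<open>1\<close>; this does
  not affect their factors.
\<close>

definition word_at :: "('i::linordered_semidom \<Rightarrow> nat) \<Rightarrow> 'i \<Rightarrow> nat \<Rightarrow> nat list" where
  "word_at x p n = map (\<lambda>j. x (p + of_nat j)) [0..<n]"

definition factors_of_length :: "('i::linordered_semidom \<Rightarrow> nat) \<Rightarrow> nat \<Rightarrow> nat list set" where
  "factors_of_length x n = {word_at x p n | p. True}"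

definition factors :: "('i::linordered_semidom \<Rightarrow> nat) \<Rightarrow> nat list set" where
  "factors x = (\<Union>n. factors_of_length x n)"

definition right_special :: "('i::linordered_semidom \<Rightarrow> nat) \<Rightarrow> nat list \<Rightarrow> bool" where
  "right_special x u \<longleftrightarrow>
     u \<in> factors x \<and> (\<exists>a b. a \<noteq> b \<and> u @ [a] \<in> factors x \<and> u @ [b] \<in> factors x)"

definition left_special :: "('i::linordered_semidom \<Rightarrow> nat) \<Rightarrow> nat list \<Rightarrow> bool" where
  "left_special x u \<longleftrightarrow>
     u \<in> factors x \<and> (\<exists>a b. a \<noteq> b \<and> a # u \<in> factors x \<and> b # u \<in> factors x)"

definition bispecial :: "('i::linordered_semidom \<Rightarrow> nat) \<Rightarrow> nat list \<Rightarrow> bool" where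
  "bispecial x u \<longleftrightarrow> right_special x u \<and> left_special x u"

definition uniformly_recurrent :: "('i::linordered_semidom \<Rightarrow> nat) \<Rightarrow> bool" where
  "uniformly_recurrent x \<longleftrightarrow>
     (\<forall>u\<in>factors x. \<exists>g::nat. \<forall>p. \<exists>d\<le>g. word_at x (p + of_nat d) (length u) = u)"

definition arnoux_rauzy :: "nat \<Rightarrow> ('i::linordered_semidom \<Rightarrow> nat) \<Rightarrow> bool" where
  "arnoux_rauzy k x \<longleftrightarrow>
     range x \<subseteq> alphabet k \<and>
     uniformly_recurrent x \<and>
     (\<forall>n\<ge>1. card (factors_of_length x n) = (k - 1) * n + 1) \<and>
     (\<forall>n\<ge>1. (\<exists>!u. u \<in> factors_of_length x n \<and> right_special x u) \<and>
             (\<exists>!u. u \<in> factors_of_length x n \<and> left_special x u))"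

text \<open>
  Below, \<open>w 1, w 2, \<dots>\<close> is the enumeration of the bispecial factors by increasing length, and only
  the values of \<open>w\<close> and \<open>i\<close> at arguments \<open>\<ge> 1\<close> matter.
\<close>

definition has_index_sequence :: "('i::linordered_semidom \<Rightarrow> nat) \<Rightarrow> (nat \<Rightarrow> nat) \<Rightarrow> bool" where
  "has_index_sequence x i \<longleftrightarrow>
     (\<exists>w :: nat \<Rightarrow> nat list.
        bij_betw w {1..} {u. bispecial x u} \<and>
        w 1 = [] \<and>
        (\<forall>n\<ge>1. length (w n) < length (w (n + 1))) \<and>
        (\<forall>n\<ge>1. \<forall>a. right_special x (a # w n) \<longleftrightarrow> a = i n))"

definition two_sided_subshift :: "nat \<Rightarrow> ('i::linordered_semidom \<Rightarrow> nat) \<Rightarrow> (int \<Rightarrow> nat) set" where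
  "two_sided_subshift k x =
     {y. range y \<subseteq> alphabet k \<and> (\<forall>n\<ge>1. factors_of_length y n = factors_of_length x n)}"

text \<open>
  All Arnoux-Rauzy sequences with the same index sequence generate the same subshift, so the
  union is that of a single \<open>x\<close>.
\<close>

definition AR_subshift :: "nat \<Rightarrow> (nat \<Rightarrow> nat) \<Rightarrow> (int \<Rightarrow> nat) set" where
  "AR_subshift k i =
     (\<Union>x \<in> {x :: nat \<Rightarrow> nat. arnoux_rauzy k x \<and> has_index_sequence x i}. two_sided_subshift k x)"

definition tribonacci_subshift :: "(int \<Rightarrow> nat) set" where
  "tribonacci_subshift = AR_subshift 3 (\<lambda>n. (n - 1) mod 3 + 1)"

section \<open>Invariant measures\<close>

definition shift :: "(int \<Rightarrow> nat) \<Rightarrow> int \<Rightarrow> nat" where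
  "shift x = (\<lambda>n. x (n + 1))"

text \<open>
  The Borel sets of \<open>int \<Rightarrow> nat\<close> are those of the product topology, with \<open>nat\<close> discrete.
\<close>

definition invariant_prob_measure :: "(int \<Rightarrow> nat) set \<Rightarrow> (int \<Rightarrow> nat) measure \<Rightarrow> bool" where
  "invariant_prob_measure X \<nu> \<longleftrightarrow>
     prob_space \<nu> \<and> sets \<nu> = sets (restrict_space borel X) \<and>
     shift \<in> \<nu> \<rightarrow>\<^sub>M \<nu> \<and> distr \<nu> \<nu> shift = \<nu>"

section \<open>Operators on square-summable sequences\<close>

definition ell2 :: "(int \<Rightarrow> complex) set" where
  "ell2 = {\<phi>. (\<lambda>n. (cmod (\<phi> n))\<^sup>2) summable_on UNIV}"

text \<open>The inner product is linear in the second argument.\<close>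

definition ell2_inner :: "(int \<Rightarrow> complex) \<Rightarrow> (int \<Rightarrow> complex) \<Rightarrow> complex" where
  "ell2_inner \<phi> \<psi> = (\<Sum>\<^sub>\<infinity>n. cnj (\<phi> n) * \<psi> n)"

definition ell2_norm :: "(int \<Rightarrow> complex) \<Rightarrow> real" where
  "ell2_norm \<phi> = sqrt (\<Sum>\<^sub>\<infinity>n. (cmod (\<phi> n))\<^sup>2)"

type_synonym seq_operator = "(int \<Rightarrow> complex) \<Rightarrow> int \<Rightarrow> complex"

definition minus_scalar :: "seq_operator \<Rightarrow> complex \<Rightarrow> seq_operator" where
  "minus_scalar A z \<psi> = (\<lambda>n. A \<psi> n - z * \<psi> n)"

definition resolvent :: "seq_operator \<Rightarrow> complex \<Rightarrow> seq_operator" where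
  "resolvent A z = the_inv_into ell2 (minus_scalar A z)"

definition has_spectral_measure :: "seq_operator \<Rightarrow> (int \<Rightarrow> complex) \<Rightarrow> real measure \<Rightarrow> bool" where
  "has_spectral_measure A \<phi> \<mu> \<longleftrightarrow>
     finite_measure \<mu> \<and> sets \<mu> = sets borel \<and>
     (\<forall>z. Im z > 0 \<longrightarrow>
        ell2_inner \<phi> (resolvent A z \<phi>) = (\<integral>t. 1 / (complex_of_real t - z) \<partial>\<mu>))"

definition pure_point :: "real measure \<Rightarrow> bool" where
  "pure_point \<mu> \<longleftrightarrow> (\<exists>C. countable C \<and> emeasure \<mu> (UNIV - C) = 0)"

text \<open>
  For a bounded self-adjoint operator, every vector has exactly one spectral measure.
\<close>

definition pp_subspace :: "seq_operator \<Rightarrow> (int \<Rightarrow> complex) set" where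
  "pp_subspace A = {\<phi> \<in> ell2. \<exists>\<mu>. has_spectral_measure A \<phi> \<mu> \<and> pure_point \<mu>}"

text \<open>
  The spectrum of the restriction of \<open>A\<close> to the subspace \<open>M\<close>: the complement of the set of \<open>z\<close>
  for which \<open>A - z\<close> maps \<open>M\<close> bijectively onto \<open>M\<close> with bounded inverse.
\<close>

definition spectrum_on :: "(int \<Rightarrow> complex) set \<Rightarrow> seq_operator \<Rightarrow> complex set" where
  "spectrum_on M A =
     {z. \<not> (bij_betw (minus_scalar A z) M M \<and>
            (\<exists>C. \<forall>\<psi>\<in>M. ell2_norm \<psi> \<le> C * ell2_norm (minus_scalar A z \<psi>)))}"

definition pp_spectrum :: "seq_operator \<Rightarrow> complex set" where
  "pp_spectrum A = spectrum_on (pp_subspace A) A"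

definition schrodinger_op :: "(nat \<Rightarrow> real) \<Rightarrow> (int \<Rightarrow> nat) \<Rightarrow> seq_operator" where
  "schrodinger_op f x \<phi> = (\<lambda>n. \<phi> (n + 1) + \<phi> (n - 1) + complex_of_real (f (x n)) * \<phi> n)"

end

theory Submission
  imports Defs "HOL-Library.Sublist"
begin

text \<open>
  Tribonacci sequences contain, at every scale and with positive frequency, words that are a
  little longer than a cube, and cubes are incompatible with decaying solutions of
  \<open>u (n + 1) + u (n - 1) + V n * u n = E * u n\<close>.

  Gordon's argument (\<open>gordon_three_block\<close>). If \<open>V\<close> has period \<open>p\<close> on the three blocks of length
  \<open>p\<close> around a site \<open>m\<close>, the transfer matrix over each block is the same \<open>2 \<times> 2\<close> matrix of
  determinant \<open>1\<close>. By the Cayley-Hamilton theorem \<open>u m\<close> is then controlled by the values of \<open>u\<close> at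
  distance \<open>p\<close> and \<open>2 p\<close>. If this happens at one site \<open>m\<close> for arbitrarily large \<open>p\<close>, a
  square-summable solution vanishes at \<open>m\<close> and at \<open>m - 1\<close>, hence everywhere.

  Almost every sequence has such a site (\<open>AE_orbit_meets_limsup\<close>). Fix the scale \<open>p\<close>. If every
  window of length proportional to \<open>p\<close> contains a word of period \<open>p\<close> whose length exceeds \<open>3 p\<close> by
  a fixed fraction of \<open>p\<close>, then the sites at the centre of a cube of period \<open>p\<close> have frequency at
  least some \<open>c > 0\<close> in each orbit, with \<open>c\<close> independent of \<open>p\<close>. The points such that no
  point of their orbit lies in infinitely many of these sets form a forward invariant set \<open>B\<close>.
  Because of the invariance, averaging can be restricted to \<open>B\<close> and shows that each of the sets
  fills at least the proportion \<open>c\<close> of \<open>B\<close>. The same bound holds for their limes superior, which is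
  disjoint from \<open>B\<close>; hence \<open>B\<close> is null.

  Long repetitions come from desubstitution. Let \<open>L\<close> be the language of an Arnoux-Rauzy sequence
  with index sequence \<open>i\<close>. The letter \<open>a = i 0\<close> separates all others, so words of \<open>L\<close> are, up to
  incomplete blocks at the ends, concatenations of blocks \<open>a\<close> and \<open>a b\<close>, that is, images under the
  substitution \<open>a \<mapsto> a, b \<mapsto> a b\<close>. The preimages form again an Arnoux-Rauzy language, with the index sequence
  shifted by one (\<open>derived_ar_language\<close>). For the index sequence \<open>1, 2, 3, 1, 2, 3, \<dots>\<close> three steps
  lead back to the start, so each word of the Tribonacci language lies in \<open>(trib ^^ n) u\<close> for
  some word \<open>u\<close> of a language with the same properties. Every long enough \<open>u\<close> contains the square
  \<open>1 1\<close>; its image is a square of \<open>(trib ^^ n) [1]\<close>, and because all images of letters have long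
  common prefixes it continues into a third copy and beyond (\<open>cube_word\<close>).

  It remains to see that without eigenvalues there is no pure point spectrum. A non-zero vector
  with pure point spectral measure has an atom at some \<open>E\<close>. The vectors
  \<open>- \<i> \<epsilon> (H - E - \<i> \<epsilon>)\<inverse> \<phi>\<close> are bounded, and a pointwise limit of them for \<open>\<epsilon> \<rightarrow> 0\<close> is
  an eigenvector, which is non-zero because its inner product with \<open>\<phi>\<close> is the mass of the atom
  (\<open>atom_eigenvector\<close>).
\<close>

section \<open>Desubstitution of Arnoux-Rauzy languages\<close>

definition ext_right :: "'a list set \<Rightarrow> 'a list \<Rightarrow> bool" where
  "ext_right L u \<longleftrightarrow> (\<exists>a b. a \<noteq> b \<and> u @ [a] \<in> L \<and> u @ [b] \<in> L)"

definition ext_left :: "'a list set \<Rightarrow> 'a list \<Rightarrow> bool" where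
  "ext_left L u \<longleftrightarrow> (\<exists>a b. a \<noteq> b \<and> a # u \<in> L \<and> b # u \<in> L)"

text \<open>The elementary episturmian morphism, or Arnoux-Rauzy substitution, of the letter \<open>a\<close>.\<close>
definition ar_subst :: "'a \<Rightarrow> 'a list \<Rightarrow> 'a list" where
  "ar_subst a u = concat (map (\<lambda>b. if b = a then [a] else [a, b]) u)"

lemma ar_subst_simps [simp]:
  "ar_subst a [] = []"
  "ar_subst a (b # u) = (if b = a then [a] else [a, b]) @ ar_subst a u"
  "ar_subst a (u @ v) = ar_subst a u @ ar_subst a v"
  by (auto simp: ar_subst_def)

lemma ar_subst_snoc_hd: "\<exists>t. ar_subst a u @ [a] = a # t"
  by (cases u) auto

lemma set_ar_subst: "set u \<subseteq> set (ar_subst a u)"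
  by (induction u) auto

text \<open>
  The letter \<open>a\<close> at the end makes each block of the shorter word recognizable: without it, the
  block \<open>a\<close> would be a prefix of every other block.
\<close>
lemma prefix_ar_subst_snocD: "prefix (ar_subst a u @ [a]) (ar_subst a v @ [a]) \<Longrightarrow> prefix u v"
proof (induction u arbitrary: v)
  case (Cons c u)
  show ?case
  proof (cases v)
    case Nil
    with Cons.prems show ?thesis by (cases u) (auto split: if_splits)
  next
    case (Cons d v')
    obtain s t where st: "ar_subst a u @ [a] = a # s" "ar_subst a v' @ [a] = a # t"
      using ar_subst_snoc_hd by metis
    have "c = d"
      using Cons.prems st unfolding \<open>v = d # v'\<close> by (auto split: if_splits)
    moreover have "prefix (ar_subst a u @ [a]) (ar_subst a v' @ [a])"
      using Cons.prems unfolding \<open>v = d # v'\<close> \<open>c = d\<close> by (auto split: if_splits)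
    ultimately show ?thesis
      using Cons.IH \<open>v = d # v'\<close> by simp
  qed
qed simp

lemma ar_subst_snoc_inj: "ar_subst a u @ [a] = ar_subst a v @ [a] \<Longrightarrow> u = v"
  by (metis prefix_order.antisym prefix_order.refl prefix_ar_subst_snocD)

text \<open>
  The language of an Arnoux-Rauzy sequence, with bispecial words and indices counted from \<open>0\<close>.
  Only languages are desubstituted, never sequences: this spares the choice of a
  desubstituted two-sided sequence and of its origin. The uniqueness of left special words of
  each length is expressed by comparability with respect to prefixes, since lengths are not
  preserved by the substitution while prefixes are.
\<close>
locale ar_language =
  fixes A :: "'a set" and L :: "'a list set" and i :: "nat \<Rightarrow> 'a"
  assumes alphabet: "u \<in> L \<Longrightarrow> set u \<subseteq> A"
    and factorial: "x @ u @ y \<in> L \<Longrightarrow> u \<in> L"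
    and irreducible: "u \<in> L \<Longrightarrow> v \<in> L \<Longrightarrow> \<exists>t. u @ t @ v \<in> L"
    and right_full: "ext_right L u \<Longrightarrow> c \<in> A \<Longrightarrow> u @ [c] \<in> L"
    and left_chain: "ext_left L u \<Longrightarrow> ext_left L v \<Longrightarrow> prefix u v \<or> prefix v u"
    and index: "\<exists>w. range w = {u. ext_right L u \<and> ext_left L u} \<and> w 0 = [] \<and>
                  (\<forall>n. length (w n) < length (w (Suc n))) \<and>
                  (\<forall>n a. ext_right L (a # w n) \<longleftrightarrow> a = i n)"
begin

lemma factorial_prefix: "u @ y \<in> L \<Longrightarrow> u \<in> L"
  using factorial[of "[]" u y] by simp

lemma factorial_suffix: "x @ u \<in> L \<Longrightarrow> u \<in> L"
  using factorial[of x u "[]"] by simp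

lemma right_special_first: "ext_right L [c] \<longleftrightarrow> c = i 0"
  using index by metis

lemma first_in: "[i 0] \<in> L"
  using right_special_first[of "i 0"] factorial_prefix unfolding ext_right_def by blast

lemma first_in_A: "i 0 \<in> A"
  using alphabet[OF first_in] by simp

lemma first_then: "c \<in> A \<Longrightarrow> [i 0, c] \<in> L"
  using right_full[of "[i 0]" c] right_special_first by simp

lemma extend_right: "u \<in> L \<Longrightarrow> \<exists>c. u @ [c] \<in> L"
proof -
  assume "u \<in> L"
  then obtain t where t: "u @ t @ [i 0] \<in> L"
    using irreducible first_in by blast
  then show ?thesis
    by (cases t) (use factorial_prefix[of "u @ [_]"] in auto)
qed

lemma extend_left: "u \<in> L \<Longrightarrow> \<exists>c. c # u \<in> L"
proof -
  assume "u \<in> L"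
  then obtain t where t: "[i 0] @ t @ u \<in> L"
    using irreducible first_in by blast
  show ?thesis
  proof (cases t rule: rev_cases)
    case Nil
    then show ?thesis using t by auto
  next
    case (snoc s c)
    then show ?thesis using t factorial_suffix[of "i 0 # s" "c # u"] by auto
  qed
qed

text \<open>
  A left special letter \<open>d\<close> other than \<open>i 0\<close> would have a single successor. That successor also
  follows \<open>i 0\<close>, so it is left special and hence equal to \<open>d\<close>. Then nothing but \<open>d\<close> could ever
  follow \<open>d\<close>, against irreducibility.
\<close>
lemma left_special_letter:
  assumes "ext_left L [d]"
  shows "d = i 0"
proof (rule ccontr)
  assume d: "d \<noteq> i 0"
  have dA: "d \<in> A"
    using assms alphabet unfolding ext_left_def by fastforce
  have only: "e = d" if "[d, e] \<in> L" for e
  proof -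
    have "[i 0, e] \<in> L"
      using first_then alphabet[OF that] by simp
    then have "ext_left L [e]"
      using that d unfolding ext_left_def by metis
    then show ?thesis
      using left_chain[OF assms, of "[e]"] by auto
  qed
  have const: "d # s \<in> L \<Longrightarrow> set s \<subseteq> {d}" for s
  proof (induction s)
    case (Cons e s)
    have "e = d"
      using only factorial_prefix[of "[d, e]" s] Cons.prems by simp
    then show ?case
      using Cons factorial_suffix[of "[d]" "e # s"] by simp
  qed simp
  have "[d] \<in> L"
    using first_then[OF dA] factorial_suffix[of "[i 0]" "[d]"] by simp
  then obtain t where "[d] @ t @ [i 0] \<in> L"
    using irreducible first_in by blast
  then show False
    using const[of "t @ [i 0]"] d by auto
qed

text \<open>Every letter follows \<open>i 0\<close>, so a letter that also follows some \<open>c \<noteq> i 0\<close> is left special.\<close>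
lemma separating:
  assumes "[c, d] \<in> L" "c \<noteq> i 0"
  shows "d = i 0"
proof -
  have "[i 0, d] \<in> L"
    using first_then alphabet[OF assms(1)] by simp
  then have "ext_left L [d]"
    using assms unfolding ext_left_def by metis
  then show ?thesis by (rule left_special_letter)
qed

lemma parse:
  assumes "v \<in> L" "v \<noteq> []" "hd v = i 0" "last v = i 0"
  shows "\<exists>u. v = ar_subst (i 0) u @ [i 0]"
  using assms
proof (induction "length v" arbitrary: v rule: less_induct)
  case less
  obtain v' where v: "v = i 0 # v'"
    using less.prems by (cases v) auto
  show ?case
  proof (cases v')
    case Nil
    then show ?thesis using v by (intro exI[of _ "[]"]) simp
  next
    case (Cons c v'')
    have inL: "v' \<in> L"
      using less.prems(1) v factorial_suffix[of "[i 0]" v'] by simp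
    show ?thesis
    proof (cases "c = i 0")
      case True
      then obtain u where "v' = ar_subst (i 0) u @ [i 0]"
        using less.hyps[of v'] inL v Cons less.prems by auto
      then show ?thesis
        using v by (intro exI[of _ "i 0 # u"]) simp
    next
      case False
      then obtain d v3 where v3: "v'' = d # v3"
        using less.prems(4) v Cons by (cases v'') auto
      have "d = i 0"
        using separating[of c d] False factorial_prefix[of "[c, d]" v3] inL Cons v3 by simp
      moreover have "v'' \<in> L"
        using inL Cons factorial_suffix[of "[c]" v''] by simp
      ultimately obtain u where "v'' = ar_subst (i 0) u @ [i 0]"
        using less.hyps[of v''] v Cons v3 less.prems by auto
      then show ?thesis
        using v Cons False by (intro exI[of _ "c # u"]) simp
    qed
  qed
qed

text \<open>
  The words that \<open>L\<close> is made of after desubstitution. The extra \<open>i 0\<close> costs nothing, as every block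
  is followed by it, and it turns extensions of \<open>u\<close> into extensions of its image by the same letter
  (see \<open>derived_right\<close> and \<open>derived_left\<close>).
\<close>
definition derived :: "'a list set" where
  "derived = {u. ar_subst (i 0) u @ [i 0] \<in> L}"

abbreviation lift :: "'a list \<Rightarrow> 'a list" where
  "lift u \<equiv> ar_subst (i 0) u @ [i 0]"

lemma prepend_first: "c # u \<in> L \<Longrightarrow> c \<noteq> i 0 \<Longrightarrow> i 0 # c # u \<in> L"
proof -
  assume *: "c # u \<in> L" "c \<noteq> i 0"
  then obtain d where d: "d # c # u \<in> L"
    using extend_left by blast
  then have "[d, c] \<in> L"
    using factorial_prefix[of "[d, c]" u] by simp
  then show ?thesis
    using separating[of d c] * d by blast
qed

lemma append_first: "u @ [c] \<in> L \<Longrightarrow> c \<noteq> i 0 \<Longrightarrow> u @ [c, i 0] \<in> L"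
proof -
  assume *: "u @ [c] \<in> L" "c \<noteq> i 0"
  then obtain d where d: "u @ [c, d] \<in> L"
    using extend_right by force
  then have "[c, d] \<in> L"
    using factorial_suffix[of u "[c, d]"] by simp
  then show ?thesis
    using separating[of c d] * d by blast
qed

lemma derived_right: "u @ [c] \<in> derived \<longleftrightarrow> lift u @ [c] \<in> L"
proof (cases "c = i 0")
  case False
  have "lift (u @ [c]) = lift u @ [c, i 0]" using False by simp
  then show ?thesis
    using append_first[of "lift u" c] False factorial_prefix[of "lift u @ [c]" "[i 0]"]
    unfolding derived_def by auto
qed (simp add: derived_def)

lemma derived_left: "c # u \<in> derived \<longleftrightarrow> c # lift u \<in> L"
proof (cases "c = i 0")
  case False
  have "lift (c # u) = i 0 # c # lift u" using False by simp
  then show ?thesis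
    using prepend_first[of c "lift u"] False factorial_suffix[of "[i 0]" "c # lift u"]
    unfolding derived_def by auto
qed (simp add: derived_def)

lemma derived_ext_right: "ext_right derived u \<longleftrightarrow> ext_right L (lift u)"
  unfolding ext_right_def derived_right ..

lemma derived_ext_left: "ext_left derived u \<longleftrightarrow> ext_left L (lift u)"
  unfolding ext_left_def derived_left ..

lemma derived_ext_right_Cons: "ext_right derived (c # u) \<longleftrightarrow> ext_right L (c # lift u)"
proof (cases "c = i 0")
  case False
  have "lift (c # u) = i 0 # c # lift u" using False by simp
  moreover have "i 0 # c # lift u @ [x] \<in> L \<longleftrightarrow> c # lift u @ [x] \<in> L" for x
    using prepend_first[of c "lift u @ [x]"] False factorial_suffix[of "[i 0]" "c # lift u @ [x]"]
    by auto
  ultimately show ?thesis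
    unfolding derived_ext_right by (simp add: ext_right_def)
qed (simp add: derived_ext_right)

text \<open>
  A first letter other than \<open>i 0\<close> has only \<open>i 0\<close> to its left, so it does not start a left special
  word. The same holds for the last letter and right special words.
\<close>
lemma bispecial_lift:
  assumes "ext_right L v" "ext_left L v" "v \<noteq> []"
  shows "\<exists>u. v = lift u"
proof (rule parse)
  obtain a b where ab: "a \<noteq> b" "v @ [a] \<in> L" "v @ [b] \<in> L"
    using assms(1) unfolding ext_right_def by blast
  obtain c d where cd: "c \<noteq> d" "c # v \<in> L" "d # v \<in> L"
    using assms(2) unfolding ext_left_def by blast
  show "v \<in> L" using ab factorial_prefix by blast
  show "v \<noteq> []" by fact
  obtain h t where ht: "v = h # t"
    using assms(3) by (cases v) auto
  have "[c, h] \<in> L" "[d, h] \<in> L"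
    using cd factorial_prefix[of "[_, h]" t] ht by auto
  then show "hd v = i 0"
    using separating cd(1) ht by (metis list.sel(1))
  obtain s l where sl: "v = s @ [l]"
    using assms(3) by (cases v rule: rev_cases) auto
  have "[l, a] \<in> L" "[l, b] \<in> L"
    using ab factorial_suffix[of s "[l, _]"] sl by auto
  then show "last v = i 0"
    using separating ab(1) sl by (metis last_snoc)
qed

text \<open>
  Right and left special words, and the letters that extend them, correspond to each other under
  \<open>lift\<close>. The image of \<open>lift\<close> contains all bispecial words of \<open>L\<close> except the empty one, so the
  enumeration of bispecial words loses its first element and the index sequence is shifted.
\<close>
theorem derived_ar_language: "ar_language A derived (\<lambda>n. i (Suc n))"
proof
  fix u assume "u \<in> derived"
  then show "set u \<subseteq> A"
    using alphabet[of "lift u"] set_ar_subst[of u "i 0"] unfolding derived_def by auto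
next
  fix x u y assume *: "x @ u @ y \<in> derived"
  obtain t where "ar_subst (i 0) y @ [i 0] = i 0 # t" using ar_subst_snoc_hd by metis
  then have "lift (x @ u @ y) = ar_subst (i 0) x @ lift u @ t" by simp
  then show "u \<in> derived"
    using * factorial unfolding derived_def by (metis mem_Collect_eq)
next
  fix u v assume *: "u \<in> derived" "v \<in> derived"
  then obtain t where t: "lift u @ t @ lift v \<in> L"
    using irreducible unfolding derived_def by blast
  obtain r where r: "lift v = i 0 # r" using ar_subst_snoc_hd by metis
  have "ar_subst (i 0) u @ ([i 0] @ t @ [i 0]) @ r \<in> L"
    using t r by simp
  then have "[i 0] @ t @ [i 0] \<in> L"
    by (rule factorial)
  then obtain s where "[i 0] @ t @ [i 0] = lift s"
    using parse[of "[i 0] @ t @ [i 0]"] by auto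
  then have "ar_subst (i 0) s = i 0 # t"
    by simp
  then have "lift (u @ s @ v) \<in> L"
    using t by simp
  then show "\<exists>t. u @ t @ v \<in> derived"
    unfolding derived_def by blast
next
  fix u c assume "ext_right derived u" "c \<in> A"
  then show "u @ [c] \<in> derived"
    unfolding derived_ext_right derived_right by (rule right_full)
next
  fix u v assume "ext_left derived u" "ext_left derived v"
  then show "prefix u v \<or> prefix v u"
    unfolding derived_ext_left using left_chain prefix_ar_subst_snocD by metis
next
  obtain w where w: "range w = {u. ext_right L u \<and> ext_left L u}" "w 0 = []"
      "\<And>n. length (w n) < length (w (Suc n))" "\<And>n a. ext_right L (a # w n) \<longleftrightarrow> a = i n"
    using index by auto
  have len: "n \<le> length (w n)" for n
  proof (induction n)
    case (Suc n) then show ?case using w(3)[of n] by simp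
  qed simp
  have "\<exists>u. w (Suc n) = lift u" for n
  proof (rule bispecial_lift)
    have "w (Suc n) \<in> {u. ext_right L u \<and> ext_left L u}"
      using w(1) by blast
    then show "ext_right L (w (Suc n))" "ext_left L (w (Suc n))" by auto
    show "w (Suc n) \<noteq> []" using len[of "Suc n"] by auto
  qed
  then obtain w' where w': "\<And>n. w (Suc n) = lift (w' n)"
    by metis
  have bisp: "(\<exists>n. u = w' n) \<longleftrightarrow> ext_right derived u \<and> ext_left derived u" for u
  proof -
    have "ext_right derived u \<and> ext_left derived u \<longleftrightarrow> lift u \<in> range w"
      unfolding derived_ext_right derived_ext_left w(1) by simp
    also have "\<dots> \<longleftrightarrow> (\<exists>n. lift u = w (Suc n))"
      using w(2) by (metis not0_implies_Suc rangeE rangeI snoc_eq_iff_butlast)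
    also have "\<dots> \<longleftrightarrow> (\<exists>n. u = w' n)"
      unfolding w' using ar_subst_snoc_inj by metis
    finally show ?thesis by simp
  qed
  then have range: "range w' = {u. ext_right derived u \<and> ext_left derived u}"
    by auto
  have "ext_left L [i 0]"
  proof -
    have "ext_right L []" using w(1,2) by (metis (mono_tags, lifting) mem_Collect_eq rangeI)
    then obtain b where b: "b \<noteq> i 0" "[b] \<in> L"
      unfolding ext_right_def by (metis append_Nil)
    then obtain e where "[b, e] \<in> L" using extend_right by force
    then have "[b, i 0] \<in> L" using separating b(1) by metis
    then show ?thesis
      using first_then[OF first_in_A] b(1) unfolding ext_left_def by metis
  qed
  then have "ext_right derived [] \<and> ext_left derived []"
    unfolding derived_ext_right derived_ext_left using right_special_first by simp
  then obtain m where m: "[] = w' m" using bisp by blast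
  have "Suc m \<le> 1" using len[of "Suc m"] w'[of m] m by (metis append_Nil length_Cons list.size(3) ar_subst_simps(1) One_nat_def)
  then have zero: "w' 0 = []" using m by simp
  have mono: "length (w' n) < length (w' (Suc n))" for n
  proof (rule ccontr)
    assume *: "\<not> length (w' n) < length (w' (Suc n))"
    have "ext_left L (lift (w' n))" "ext_left L (lift (w' (Suc n)))"
      using bisp derived_ext_left by metis+
    then have "prefix (w' n) (w' (Suc n)) \<or> prefix (w' (Suc n)) (w' n)"
      using left_chain prefix_ar_subst_snocD by metis
    then have "prefix (w' (Suc n)) (w' n)"
      using * by (metis not_equal_is_parallel parallelE prefix_length_le prefix_order.order_iff_strict
          linorder_not_less prefix_length_less)
    then obtain r where "w' n = w' (Suc n) @ r" by (auto elim: prefixE)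
    then have "length (lift (w' (Suc n))) \<le> length (lift (w' n))" by simp
    then show False using w(3)[of "Suc n"] w' by (metis linorder_not_less)
  qed
  have "ext_right derived (a # w' n) \<longleftrightarrow> a = i (Suc n)" for a n
    unfolding derived_ext_right_Cons w'[symmetric] by (rule w(4))
  with range zero mono show "\<exists>w. range w = {u. ext_right derived u \<and> ext_left derived u} \<and> w 0 = [] \<and>
                  (\<forall>n. length (w n) < length (w (Suc n))) \<and>
                  (\<forall>n a. ext_right derived (a # w n) \<longleftrightarrow> a = i (Suc n))"
    by blast
qed

text \<open>
  A word of \<open>L\<close> is extended by at most one letter on the left and two on the right until it starts
  with \<open>i 0\<close> and is followed by \<open>i 0\<close>. It then consists of complete blocks.
\<close>
lemma derived_cover:
  assumes "v \<in> L"
  shows "\<exists>u\<in>derived. sublist v (ar_subst (i 0) u)"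
proof -
  obtain b where b: "v @ [b] \<in> L" using assms extend_right by blast
  obtain r where r: "v @ r @ [i 0] \<in> L"
  proof (cases "b = i 0")
    case True then show ?thesis using b that[of "[]"] by simp
  next
    case False then show ?thesis using append_first[OF b] that[of "[b]"] by simp
  qed
  obtain l where l: "l @ v @ r @ [i 0] \<in> L" "hd (l @ v @ r @ [i 0]) = i 0"
  proof (cases "hd (v @ r @ [i 0]) = i 0")
    case True then show ?thesis using r that[of "[]"] by simp
  next
    case False
    then show ?thesis
      using r that[of "[i 0]"] prepend_first[of "hd (v @ r @ [i 0])" "tl (v @ r @ [i 0])"] by simp
  qed
  then obtain u where u: "l @ v @ r @ [i 0] = lift u"
    using parse[of "l @ v @ r @ [i 0]"] by auto
  then have "u \<in> derived" using l(1) unfolding u derived_def by simp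
  moreover have "sublist v (ar_subst (i 0) u)"
    using u by (metis append.assoc append_same_eq sublist_appendI)
  ultimately show ?thesis by blast
qed

end

section \<open>The Tribonacci substitution and its cubes\<close>

text \<open>
  Three desubstitution steps at once. This is the substitution
  \<open>1 \<mapsto> 1213121, 2 \<mapsto> 121312, 3 \<mapsto> 1213\<close>, see \<open>trib_simps\<close>.
\<close>
definition trib :: "nat list \<Rightarrow> nat list" where
  "trib u = ar_subst 1 (ar_subst 2 (ar_subst 3 u))"

lemma trib_simps [simp]:
  "trib [] = []"
  "trib (u @ v) = trib u @ trib v"
  "trib (Suc 0 # u) = [1, 2, 1, 3, 1, 2, 1] @ trib u"
  "trib (2 # u) = [1, 2, 1, 3, 1, 2] @ trib u"
  "trib (3 # u) = [1, 2, 1, 3] @ trib u"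
  by (simp_all add: trib_def)

lemma trib_pow_Nil [simp]: "(trib ^^ n) [] = []"
  by (induction n) auto

lemma trib_pow_append: "(trib ^^ n) (u @ v) = (trib ^^ n) u @ (trib ^^ n) v"
  by (induction n arbitrary: u v) auto

lemma trib_pow_Suc: "(trib ^^ Suc n) u = (trib ^^ n) (trib u)"
  by (simp add: funpow_swap1)

lemma sublist_obtain: "sublist u v \<Longrightarrow> (\<And>x y. v = x @ u @ y \<Longrightarrow> thesis) \<Longrightarrow> thesis"
  unfolding sublist_def by blast

lemma sublist_ar_subst: "sublist u v \<Longrightarrow> sublist (ar_subst a u) (ar_subst a v)"
  by (auto elim!: sublist_obtain)

abbreviation trib_index :: "nat \<Rightarrow> nat" where "trib_index n \<equiv> n mod 3 + 1"

lemma trib_index_shift: "(\<lambda>n. trib_index (Suc (Suc (Suc n)))) = trib_index"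
  by (rule ext) presburger

lemma trib_cover_step:
  assumes "ar_language A L trib_index"
  shows "\<exists>L'. ar_language A L' trib_index \<and> (\<forall>v\<in>L. \<exists>u\<in>L'. sublist v (trib u))"
proof -
  interpret L0: ar_language A L trib_index by fact
  define L1 where "L1 = L0.derived"
  interpret L1: ar_language A L1 "\<lambda>n. trib_index (Suc n)"
    unfolding L1_def by (rule L0.derived_ar_language)
  define L2 where "L2 = L1.derived"
  interpret L2: ar_language A L2 "\<lambda>n. trib_index (Suc (Suc n))"
    unfolding L2_def by (rule L1.derived_ar_language)
  have idx: "trib_index 0 = 1" "trib_index (Suc 0) = 2" "trib_index (Suc (Suc 0)) = 3"
    by simp_all
  have "ar_language A L2.derived trib_index"
    using L2.derived_ar_language unfolding trib_index_shift .
  moreover have "\<exists>u\<in>L2.derived. sublist v (trib u)" if v: "v \<in> L" for v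
  proof -
    obtain u1 where u1: "u1 \<in> L1" "sublist v (ar_subst 1 u1)"
      using L0.derived_cover[OF v] unfolding L1_def idx by blast
    obtain u2 where u2: "u2 \<in> L2" "sublist u1 (ar_subst 2 u2)"
      using L1.derived_cover[OF u1(1)] unfolding L2_def idx by blast
    obtain u3 where u3: "u3 \<in> L2.derived" "sublist u2 (ar_subst 3 u3)"
      using L2.derived_cover[OF u2(1)] unfolding idx by blast
    have "sublist u1 (ar_subst 2 (ar_subst 3 u3))"
      using u2(2) sublist_ar_subst[OF u3(2)] by (rule sublist_order.order.trans)
    then have "sublist v (trib u3)"
      unfolding trib_def by (rule sublist_order.order.trans[OF u1(2) sublist_ar_subst])
    then show ?thesis using u3(1) by blast
  qed
  ultimately show ?thesis by blast
qed

lemma sublist_trib_pow: "sublist u v \<Longrightarrow> sublist ((trib ^^ n) u) ((trib ^^ n) v)"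
  by (auto elim!: sublist_obtain simp: trib_pow_append)

lemma trib_cover:
  assumes "ar_language A L trib_index"
  shows "\<exists>L'. ar_language A L' trib_index \<and> (\<forall>v\<in>L. \<exists>u\<in>L'. sublist v ((trib ^^ n) u))"
proof (induction n)
  case 0
  then show ?case using assms by auto
next
  case (Suc n)
  then obtain L' where L': "ar_language A L' trib_index" "\<forall>v\<in>L. \<exists>u\<in>L'. sublist v ((trib ^^ n) u)"
    by blast
  obtain L'' where L'': "ar_language A L'' trib_index" "\<forall>v\<in>L'. \<exists>u\<in>L''. sublist v (trib u)"
    using trib_cover_step[OF L'(1)] by blast
  moreover have "\<exists>u\<in>L''. sublist v ((trib ^^ n) (trib u))" if v: "v \<in> L" for v
  proof -
    obtain u where u: "u \<in> L'" "sublist v ((trib ^^ n) u)" using L'(2) v by blast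
    obtain u' where u': "u' \<in> L''" "sublist u (trib u')" using L'' u(1) by blast
    have "sublist v ((trib ^^ n) (trib u'))"
      by (rule sublist_order.order.trans[OF u(2) sublist_trib_pow[OF u'(2)]])
    then show ?thesis using u'(1) by blast
  qed
  ultimately show ?case
    unfolding trib_pow_Suc by blast
qed

text \<open>
  A word of length \<open>(m + 1) * p\<close> in a concatenation of blocks of length at most \<open>p\<close> loses less than
  one block at its left end and still covers \<open>m\<close> complete blocks.
\<close>
lemma sublist_blocks:
  fixes g :: "'a list \<Rightarrow> 'b list"
  assumes hom: "\<And>x y. g (x @ y) = g x @ g y"
    and len: "\<And>b. b \<in> set u \<Longrightarrow> length (g [b]) \<le> p"
    and "sublist v (g u)" "(m + 1) * p \<le> length v" "v \<noteq> []"
  shows "\<exists>u'. sublist u' u \<and> length u' = m \<and> sublist (g u') v"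
proof -
  have nil: "g [] = []" using hom[of "[]" "[]"] by simp
  have bound: "length (g w) \<le> length w * p" if "set w \<subseteq> set u" for w
    using that
  proof (induction w)
    case (Cons b w)
    then show ?case using hom[of "[b]" w] len[of b] by simp
  qed (simp add: nil)
  obtain x y where g: "g u = x @ v @ y" using assms(3) unfolding sublist_def by blast
  have "\<exists>u'. sublist u' w \<and> length u' = m \<and> sublist (g u') v"
    if "g w = x @ v @ y" "set w \<subseteq> set u" for w x
    using that
  proof (induction w arbitrary: x)
    case Nil
    then show ?case using nil \<open>v \<noteq> []\<close> by simp
  next
    case (Cons b w)
    have gb: "g (b # w) = g [b] @ g w" using hom[of "[b]" w] by simp
    have "(\<exists>x'. g w = x' @ v @ y) \<or> (\<exists>s. g [b] = x @ s \<and> v @ y = s @ g w)"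
      using Cons.prems(1) unfolding gb append_eq_append_conv2 by auto
    then show ?case
    proof (elim disjE exE conjE)
      fix x' assume "g w = x' @ v @ y"
      then obtain u' where "sublist u' w" "length u' = m" "sublist (g u') v"
        using Cons.IH Cons.prems(2) by auto
      then show ?thesis
        by (intro exI[of _ u']) (simp add: sublist_Cons_right)
    next
      fix s assume s: "g [b] = x @ s" and vy: "v @ y = s @ g w"
      have "length s \<le> p" using s len[of b] Cons.prems(2) by auto
      then have mp: "m * p \<le> length v - length s" "length s \<le> length v"
        using assms(4) by auto
      obtain v' where v: "v = s @ v'" "g w = v' @ y"
        using vy mp(2) unfolding append_eq_append_conv2 by auto
      let ?u = "take m w"
      have "set ?u \<subseteq> set u" using Cons.prems(2) set_take_subset[of m w] by auto
      then have "length (g ?u) \<le> length ?u * p" by (rule bound)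
      also have "\<dots> \<le> m * p" by simp
      also have "\<dots> \<le> length v'" using mp v(1) by simp
      finally have le: "length (g ?u) \<le> length v'" .
      have "g w = g ?u @ g (drop m w)" by (metis append_take_drop_id hom)
      then have "g ?u @ g (drop m w) = v' @ y" using v(2) by simp
      then obtain r where r: "v' = g ?u @ r"
        using le unfolding append_eq_append_conv2 by auto
      have "m \<le> length w"
      proof (rule ccontr)
        assume *: "\<not> m \<le> length w"
        have "m * p \<le> length (g w)" using mp v by simp
        also have "\<dots> \<le> length w * p"
          using bound[of w] Cons.prems(2) by auto
        finally have "p = 0" using * by simp
        then have "g w = []" using bound[of w] Cons.prems(2) by auto
        then show False
          using \<open>p = 0\<close> \<open>length s \<le> p\<close> vy \<open>v \<noteq> []\<close> by simp
      qed
      moreover have "sublist ?u (b # w)" by (simp add: sublist_Cons_right sublist_take)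
      moreover have "sublist (g ?u) v" using v(1) r by (simp add: sublist_appendI)
      ultimately show ?thesis by (intro exI[of _ ?u]) simp
    qed
  qed
  then show ?thesis using g by blast
qed

abbreviation letters :: "nat set" where "letters \<equiv> {1, 2, 3}"

lemma prefix_trib_pow: "prefix u v \<Longrightarrow> prefix ((trib ^^ n) u) ((trib ^^ n) v)"
  unfolding prefix_def using trib_pow_append by auto

text \<open>
  From the first power on, the images of the letters are nested: \<open>1213\<close> is a prefix of \<open>121312\<close>,
  which is a prefix of \<open>1213121\<close>.
\<close>
lemma trib_pow_prefix:
  assumes "b \<in> letters"
  shows "prefix ((trib ^^ Suc n) [3]) ((trib ^^ Suc n) [b])"
    and "prefix ((trib ^^ Suc n) [b]) ((trib ^^ Suc n) [1])"
  unfolding trib_pow_Suc using assms by (auto intro!: prefix_trib_pow)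

text \<open>Since \<open>1213121 = 1213 121\<close>, where \<open>121\<close> is a prefix of \<open>1213\<close>.\<close>
lemma length_trib_pow_le:
  assumes "b \<in> letters"
  shows "length ((trib ^^ Suc n) [b]) \<le> 2 * length ((trib ^^ Suc n) [3])"
proof -
  let ?g = "trib ^^ n"
  have split: "?g [1, 2, 1, 3, 1, 2, 1] = ?g [1, 2, 1, 3] @ ?g [1, 2, 1]"
    "?g [1, 2, 1, 3] = ?g [1, 2, 1] @ ?g [3]"
    using trib_pow_append[of n "[1, 2, 1, 3]" "[1, 2, 1]"] trib_pow_append[of n "[1, 2, 1]" "[3]"]
    by simp_all
  have "length ((trib ^^ Suc n) [b]) \<le> length ((trib ^^ Suc n) [1])"
    using trib_pow_prefix(2)[OF assms] by (rule prefix_length_le)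
  also have "\<dots> = length (?g [1, 2, 1, 3]) + length (?g [1, 2, 1])"
    unfolding trib_pow_Suc using split(1) by simp
  also have "\<dots> \<le> 2 * length (?g [1, 2, 1, 3])"
    using split(2) by simp
  finally show ?thesis
    unfolding trib_pow_Suc[of _ "[3]"] by simp
qed

lemma length_trib_pow_ge: "b \<in> letters \<Longrightarrow> n < length ((trib ^^ n) [b])"
proof (induction n arbitrary: b)
  case (Suc n)
  have "prefix ((trib ^^ n) [1, 2, 1, 3]) ((trib ^^ n) (trib [b]))"
    using Suc.prems by (auto intro!: prefix_trib_pow)
  then have "length ((trib ^^ n) ([1] @ [2] @ [1, 3])) \<le> length ((trib ^^ Suc n) [b])"
    unfolding trib_pow_Suc by (simp add: prefix_length_le)
  moreover have "n < length ((trib ^^ n) [1])" "n < length ((trib ^^ n) [2])"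
    using Suc.IH by auto
  ultimately show ?case unfolding trib_pow_append by simp
qed simp

text \<open>
  The letter \<open>1\<close> is separating, so one of two consecutive letters is \<open>1\<close>, and the first two of
  three letters contain a \<open>1\<close> that is followed by a letter. The image of \<open>1\<close> ends in \<open>1\<close>, and the
  image of the next letter starts with \<open>1\<close>. Images of letters have length at most \<open>7\<close>, so
  \<open>28 = 4 * 7\<close> letters cover three of them.
\<close>
lemma contains_11:
  assumes "ar_language letters L trib_index" "v \<in> L" "28 \<le> length v"
  shows "sublist [1, 1] v"
proof -
  obtain L' where L': "ar_language letters L' trib_index" "\<forall>v\<in>L. \<exists>u\<in>L'. sublist v (trib u)"
    using trib_cover_step[OF assms(1)] by blast
  interpret ar_language letters L' trib_index by fact
  obtain u where u: "u \<in> L'" "sublist v (trib u)" using L'(2) assms(2) by blast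
  have "\<exists>u'. sublist u' u \<and> length u' = 3 \<and> sublist (trib u') v"
  proof (rule sublist_blocks[where p = 7])
    fix b assume "b \<in> set u"
    then have "b \<in> letters" using alphabet[OF u(1)] by blast
    then show "length (trib [b]) \<le> 7" by auto
  qed (use assms u in auto)
  then obtain u' where u': "sublist u' u" "length u' = 3" "sublist (trib u') v" by blast
  then obtain a b c where abc: "u' = [a, b, c]"
    by (metis length_0_conv length_Suc_conv numeral_3_eq_3)
  have in': "[a, b, c] \<in> L'"
    using u'(1) u(1) factorial unfolding abc sublist_def by auto
  then have "a \<noteq> 1 \<Longrightarrow> b = 1"
    using separating[of a b] factorial_prefix[of "[a, b]" "[c]"] by simp
  moreover have "{a, b, c} \<subseteq> letters" using alphabet[OF in'] by simp
  ultimately have "sublist [1, 1] (trib u')"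
    unfolding abc by (auto simp: sublist_code)
  then show ?thesis using u'(3) by (rule sublist_order.order.trans)
qed

text \<open>
  The scales: words of length \<open>3 * period n + excess n\<close> with period \<open>period n\<close> occur in all
  Tribonacci sequences.
\<close>
definition period :: "nat \<Rightarrow> nat" where
  "period n = length ((trib ^^ Suc (Suc n)) [1])"

definition excess :: "nat \<Rightarrow> nat" where
  "excess n = length ((trib ^^ Suc n) [3])"

lemma period_ge: "n \<le> period n"
  unfolding period_def using length_trib_pow_ge[of 1 "Suc (Suc n)"] by simp

lemma period_pos: "period n > 0"
  using length_trib_pow_ge[of 1 "Suc (Suc n)", folded period_def] by simp

lemma period_le_excess: "period n \<le> 14 * excess n"
proof -
  let ?g = "trib ^^ Suc n"
  have "trib [1] = [1] @ [2] @ [1] @ [3] @ [1] @ [2] @ [1]" by simp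
  then have "?g (trib [1]) = ?g [1] @ ?g [2] @ ?g [1] @ ?g [3] @ ?g [1] @ ?g [2] @ ?g [1]"
    unfolding trib_pow_append[symmetric] by (rule arg_cong)
  then have "period n = 4 * length (?g [1]) + 2 * length (?g [2]) + length (?g [3])"
    unfolding period_def trib_pow_Suc[of "Suc n"] by (simp del: funpow.simps)
  then show ?thesis
    using length_trib_pow_le[of 1 n] length_trib_pow_le[of 2 n] unfolding excess_def by simp
qed

text \<open>
  Images of letters have length at most \<open>period n\<close>, so \<open>v\<close> covers the image of a word of length
  \<open>30\<close>. The first \<open>28\<close> letters of this word contain \<open>11\<close>, and two letters \<open>b c\<close> follow. One application of \<open>trib\<close> to \<open>11bc\<close> gives three copies of \<open>1213121\<close> and a further
  letter, whatever \<open>b\<close> and \<open>c\<close> are. The remaining applications turn the three copies into a cube,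
  and the image of the further letter starts with the image of \<open>3\<close>, which is a prefix of the
  cube's root.
\<close>
lemma cube_word:
  assumes "ar_language letters L trib_index" "v \<in> L" "31 * period n \<le> length v"
  shows "\<exists>B D. sublist (B @ B @ B @ D) v \<and> prefix D B \<and>
    length B = period n \<and> length D = excess n"
proof -
  let ?S = "trib ^^ Suc (Suc n)" and ?g = "trib ^^ Suc n"
  define B where "B = ?S [1]"
  define D where "D = ?g [3]"
  obtain L' where L': "ar_language letters L' trib_index" "\<forall>v\<in>L. \<exists>u\<in>L'. sublist v (?S u)"
    using trib_cover[OF assms(1)] by blast
  interpret ar_language letters L' trib_index by fact
  obtain u where u: "u \<in> L'" "sublist v (?S u)" using L'(2) assms(2) by blast
  have "\<exists>u'. sublist u' u \<and> length u' = 30 \<and> sublist (?S u') v"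
  proof (rule sublist_blocks[where p = "period n"])
    fix b assume "b \<in> set u"
    then have "b \<in> letters" using alphabet[OF u(1)] by blast
    then show "length (?S [b]) \<le> period n"
      unfolding period_def by (intro prefix_length_le trib_pow_prefix)
  next
    show "v \<noteq> []" using assms(3) period_pos[of n] by auto
  next
    show "sublist v (?S u)" by (rule u)
    show "(30 + 1) * period n \<le> length v" using assms(3) by simp
  qed (rule trib_pow_append)
  then obtain u' where u': "sublist u' u" "length u' = 30" "sublist (?S u') v" by blast
  have in': "u' \<in> L'" using u'(1) u(1) factorial unfolding sublist_def by auto
  have "take 28 u' \<in> L'" using in' factorial_prefix by (metis append_take_drop_id)
  then have "sublist [1, 1] (take 28 u')"
    using contains_11[OF L'(1)] u'(2) by simp
  then obtain x y where xy: "take 28 u' = x @ [1, 1] @ y" unfolding sublist_def by blast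
  have "length (y @ drop 28 u') \<ge> 2" using u'(2) by simp
  then obtain b c z where bc: "y @ drop 28 u' = b # c # z"
    unfolding numeral_2_eq_2 Suc_le_length_iff by blast
  have eq: "u' = x @ [1, 1, b, c] @ z"
    using append_take_drop_id[of 28 u'] unfolding xy using bc by simp
  then have bcl: "b \<in> letters" "c \<in> letters" using alphabet[OF in'] by auto
  let ?T = "[1, 2, 1, 3, 1, 2, 1] :: nat list"
  have "\<exists>e r. e \<in> letters \<and> trib [1, 1, b, c] = ?T @ ?T @ ?T @ [e] @ r"
    using bcl by auto
  then obtain e r where e: "e \<in> letters" "trib [1, 1, b, c] = ?T @ ?T @ ?T @ [e] @ r" by blast
  have "?g ?T = B" unfolding B_def trib_pow_Suc[of "Suc n"] by simp
  then have S4: "?S [1, 1, b, c] = B @ B @ B @ ?g [e] @ ?g r"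
    unfolding trib_pow_Suc[of "Suc n"] e(2) trib_pow_append by simp
  have "prefix D (?g [e])" unfolding D_def using e(1) by (rule trib_pow_prefix)
  then have "sublist (B @ B @ B @ D) (?S [1, 1, b, c])"
    unfolding S4 by (auto simp: prefix_def)
  moreover have "sublist (?S [1, 1, b, c]) (?S u')"
    unfolding eq by (rule sublist_trib_pow) (rule sublist_appendI)
  ultimately have "sublist (B @ B @ B @ D) v"
    using u'(3) by (meson sublist_order.order.trans)
  moreover have "prefix D B"
  proof -
    have "prefix D (?g [1])" unfolding D_def by (rule trib_pow_prefix) simp
    moreover have "prefix (?g [1]) (?g ?T)"
      by (rule prefix_trib_pow) simp
    ultimately show ?thesis unfolding \<open>?g ?T = B\<close> by (rule prefix_order.trans)
  qed
  ultimately show ?thesis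
    unfolding period_def excess_def B_def D_def by blast
qed

lemma cube_periodic:
  assumes "prefix D B" "k < 2 * length B + length D"
  shows "(B @ B @ B @ D) ! (k + length B) = (B @ B @ B @ D) ! k"
proof -
  obtain r where "B = D @ r" using assms(1) by (auto elim: prefixE)
  then have "B @ B @ B @ D = (B @ B @ D) @ (r @ D)" by simp
  moreover have "(B @ B @ B @ D) ! (k + length B) = (B @ B @ D) ! k"
    by (metis add.commute nth_append_length_plus)
  ultimately show ?thesis using assms(2) by (simp add: nth_append)
qed

section \<open>Cubes in the Tribonacci subshift\<close>

lemma length_word_at [simp]: "length (word_at x p n) = n"
  by (simp add: word_at_def)

lemma nth_word_at: "j < n \<Longrightarrow> word_at x p n ! j = x (p + of_nat j)"
  by (simp add: word_at_def)

lemma word_at_add: "word_at x p (m + n) = word_at x p m @ word_at x (p + of_nat m) n"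
  by (rule nth_equalityI) (auto simp: nth_word_at nth_append add.assoc simp flip: of_nat_add)

lemma word_at_in_factors: "word_at x p n \<in> factors x"
  unfolding factors_def factors_of_length_def by blast

lemma in_factorsE:
  assumes "u \<in> factors x"
  obtains p where "u = word_at x p (length u)"
  using assms unfolding factors_def factors_of_length_def by auto

lemma factors_of_length_eq: "factors_of_length x n = {u \<in> factors x. length u = n}"
  unfolding factors_def factors_of_length_def by auto

lemma word_at_split:
  assumes "word_at x p n = a @ u @ b"
  shows "u = word_at x (p + of_nat (length a)) (length u)"
proof -
  have "length (word_at x p n) = length (a @ u @ b)" using assms by simp
  then have "n = length a + (length u + length b)" by simp
  then have "a @ u @ b = word_at x p (length a) @ word_at x (p + of_nat (length a)) (length u)
      @ word_at x (p + of_nat (length a) + of_nat (length u)) (length b)"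
    using assms by (simp add: word_at_add)
  then show ?thesis by simp
qed

lemma factors_factorial: "a @ u @ b \<in> factors x \<Longrightarrow> u \<in> factors x"
  by (metis in_factorsE word_at_split word_at_in_factors)

lemma right_special_iff: "right_special x u \<longleftrightarrow> ext_right (factors x) u"
  unfolding right_special_def ext_right_def
  using factors_factorial[of "[]" u] by (metis append_Nil)

lemma left_special_iff: "left_special x u \<longleftrightarrow> ext_left (factors x) u"
  unfolding left_special_def ext_left_def
  using factors_factorial[of "[_]" u "[]"] by (metis append_Cons append_Nil append_Nil2)

lemma alphabet_3: "alphabet 3 = letters"
  unfolding alphabet_def by auto

text \<open>
  There are \<open>2 n + 1\<close> factors of length \<open>n\<close> and two more of length \<open>n + 1\<close>. All but one of them
  have a single extension to the right, so the remaining one has three. For \<open>n = 0\<close> the only factor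
  is the empty word and the same count applies.
\<close>
lemma arnoux_rauzy_right_full:
  fixes x :: "nat \<Rightarrow> nat"
  assumes "arnoux_rauzy 3 x" "ext_right (factors x) u" "c \<in> letters"
  shows "u @ [c] \<in> factors x"
proof -
  define F where "F n = factors_of_length x n" for n
  define E where "E v = {c. v @ [c] \<in> factors x}" for v
  define n where "n = length u"
  have letters: "range x \<subseteq> letters"
    using assms(1) unfolding arnoux_rauzy_def alphabet_3 by blast
  have EA: "E v \<subseteq> letters" for v
  proof
    fix c assume "c \<in> E v"
    then obtain p where p: "v @ [c] = word_at x p (length (v @ [c]))"
      unfolding E_def by (blast elim: in_factorsE)
    have "c = (v @ [c]) ! length v" by simp
    also have "\<dots> = x (p + length v)" by (subst p) (simp add: nth_word_at)
    finally show "c \<in> letters" using letters by auto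
  qed
  then have finE: "finite (E v)" for v by (rule finite_subset) simp
  have F0: "F 0 = {[]}"
    unfolding F_def factors_of_length_def word_at_def by simp
  have cardF: "card (F m) = 2 * m + 1" for m
    using assms(1) F0 unfolding arnoux_rauzy_def F_def by (cases "m = 0") auto
  then have finF: "finite (F m)" for m by (metis card.infinite add_is_0 one_neq_zero)
  have uF: "u \<in> F n"
    using assms(2) right_special_iff unfolding F_def n_def factors_of_length_eq right_special_def by auto
  have FSuc: "F (Suc n) = (\<Union>v\<in>F n. (\<lambda>c. v @ [c]) ` E v)"
  proof (intro equalityI subsetI)
    fix v assume v: "v \<in> F (Suc n)"
    then obtain v' c where vc: "v = v' @ [c]" unfolding F_def factors_of_length_eq
      by (cases v rule: rev_cases) auto
    then have "v' \<in> F n" "c \<in> E v'"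
      using v factors_factorial[of "[]" v' "[c]"] unfolding F_def factors_of_length_eq E_def by auto
    then show "v \<in> (\<Union>v\<in>F n. (\<lambda>c. v @ [c]) ` E v)" using vc by blast
  qed (auto simp: F_def factors_of_length_eq E_def)
  have "card (F (Suc n)) = (\<Sum>v\<in>F n. card ((\<lambda>c. v @ [c]) ` E v))"
    unfolding FSuc by (rule card_UN_disjoint) (use finF finE in auto)
  also have "\<dots> = (\<Sum>v\<in>F n. card (E v))"
    by (intro sum.cong refl card_image) (auto simp: inj_on_def)
  also have "\<dots> = card (E u) + (\<Sum>v\<in>F n - {u}. card (E v))"
    by (rule sum.remove[OF finF uF])
  also have "(\<Sum>v\<in>F n - {u}. card (E v)) = (\<Sum>v\<in>F n - {u}. 1)"
  proof (rule sum.cong[OF refl])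
    fix v assume v: "v \<in> F n - {u}"
    have "\<not> ext_right (factors x) v"
    proof
      assume rs: "ext_right (factors x) v"
      have "n \<noteq> 0" using v uF F0 by (cases "n = 0") auto
      then have "\<exists>!w. w \<in> F n \<and> right_special x w"
        using assms(1) unfolding arnoux_rauzy_def F_def by simp
      then show False
        using v uF rs assms(2) unfolding right_special_iff by blast
    qed
    then have le: "a = b" if "a \<in> E v" "b \<in> E v" for a b
      using that unfolding ext_right_def E_def by blast
    obtain p where p: "v = word_at x p (length v)"
      using v unfolding F_def factors_of_length_eq by (blast elim: in_factorsE)
    have "v @ [x (p + length v)] = word_at x p (length v + 1)"
      unfolding word_at_add using p by (simp add: word_at_def)
    then have "x (p + length v) \<in> E v"
      unfolding E_def using word_at_in_factors by simp
    then have "E v = {x (p + length v)}" using le by blast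
    then show "card (E v) = 1" by simp
  qed
  also have "\<dots> = 2 * n"
    using cardF[of n] finF uF by simp
  finally have "card (E u) = 3"
    using cardF[of "Suc n"] by simp
  then have "E u = letters" using EA by (intro card_subset_eq) simp_all
  then show ?thesis using assms(3) unfolding E_def by blast
qed

lemma arnoux_rauzy_left_chain:
  fixes x :: "nat \<Rightarrow> nat"
  assumes "arnoux_rauzy 3 x" "ext_left (factors x) u" "ext_left (factors x) v"
  shows "prefix u v \<or> prefix v u"
  using assms(2,3)
proof (induction "length u" "length v" arbitrary: u v rule: linorder_wlog)
  case (le u v)
  have "ext_left (factors x) (take (length u) v)"
  proof -
    obtain a b where ab: "a \<noteq> b" "a # v \<in> factors x" "b # v \<in> factors x"
      using le unfolding ext_left_def by blast
    have "c # take (length u) v \<in> factors x" if "c # v \<in> factors x" for c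
      using factors_factorial[of "[]" "c # take (length u) v" "drop (length u) v"] that by simp
    then show ?thesis using ab unfolding ext_left_def by blast
  qed
  have "u = take (length u) v"
  proof (cases "u = []")
    case False
    have mem: "w \<in> factors x" if "ext_left (factors x) w" for w
      using that left_special_iff unfolding left_special_def by blast
    from False have "\<exists>!w. w \<in> factors_of_length x (length u) \<and> left_special x w"
      using assms(1) unfolding arnoux_rauzy_def by (simp add: Suc_leI)
    moreover have "u \<in> factors_of_length x (length u) \<and> left_special x u"
      using le(2) mem unfolding left_special_iff factors_of_length_eq by simp
    moreover have "take (length u) v \<in> factors_of_length x (length u) \<and> left_special x (take (length u) v)"
      using le(1) \<open>ext_left _ (take _ _)\<close> mem unfolding left_special_iff factors_of_length_eq by simp
    ultimately show ?thesis by blast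
  qed simp
  then show ?case by (metis take_is_prefix)
next
  case (sym u v)
  then show ?case by blast
qed

theorem arnoux_rauzy_language:
  fixes x :: "nat \<Rightarrow> nat"
  assumes "arnoux_rauzy 3 x" "has_index_sequence x i"
  shows "ar_language letters (factors x) (\<lambda>n. i (Suc n))"
proof
  fix u assume "u \<in> factors x"
  then obtain p where p: "u = word_at x p (length u)" by (rule in_factorsE)
  have "set (word_at x p (length u)) \<subseteq> range x" unfolding word_at_def by auto
  moreover have "range x \<subseteq> letters"
    using assms(1) unfolding arnoux_rauzy_def alphabet_3 by blast
  ultimately show "set u \<subseteq> letters" unfolding p[symmetric] by (rule subset_trans)
next
  fix a u b assume "a @ u @ b \<in> factors x"
  then show "u \<in> factors x" by (rule factors_factorial)
next
  fix u v assume u: "u \<in> factors x" and v: "v \<in> factors x"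
  obtain p where p: "u = word_at x p (length u)" using u by (rule in_factorsE)
  obtain d where d: "word_at x (p + length u + d) (length v) = v"
    using assms(1) v unfolding arnoux_rauzy_def uniformly_recurrent_def by (metis of_nat_id)
  have "word_at x p (length u + (d + length v)) = u @ word_at x (p + length u) d @ v"
    using p d by (simp add: word_at_add)
  then show "\<exists>t. u @ t @ v \<in> factors x" by (metis word_at_in_factors)
next
  fix u c assume "ext_right (factors x) u" "c \<in> letters"
  then show "u @ [c] \<in> factors x" by (rule arnoux_rauzy_right_full[OF assms(1)])
next
  fix u v assume "ext_left (factors x) u" "ext_left (factors x) v"
  then show "prefix u v \<or> prefix v u" by (rule arnoux_rauzy_left_chain[OF assms(1)])
next
  obtain w where w: "bij_betw w {1..} {u. bispecial x u}" "w 1 = []"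
    "\<And>n. n \<ge> 1 \<Longrightarrow> length (w n) < length (w (n + 1))"
    "\<And>n a. n \<ge> 1 \<Longrightarrow> right_special x (a # w n) \<longleftrightarrow> a = i n"
    using assms(2) unfolding has_index_sequence_def by blast
  have "range (\<lambda>n. w (Suc n)) = w ` {1..}"
  proof -
    have "range Suc = {1..}" by (simp add: atLeast_Suc_greaterThan greaterThan_0)
    then show ?thesis by (metis image_image)
  qed
  then have "range (\<lambda>n. w (Suc n)) = {u. ext_right (factors x) u \<and> ext_left (factors x) u}"
    using w(1) unfolding bij_betw_def bispecial_def right_special_iff left_special_iff by simp
  then show "\<exists>w. range w = {u. ext_right (factors x) u \<and> ext_left (factors x) u} \<and> w 0 = [] \<and>
      (\<forall>n. length (w n) < length (w (Suc n))) \<and>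
      (\<forall>n a. ext_right (factors x) (a # w n) \<longleftrightarrow> a = i (Suc n))"
    using w(2-4) unfolding right_special_iff
    by (intro exI[of _ "\<lambda>n. w (Suc n)"]) simp
qed

text \<open>
  The window of length \<open>31 * period n\<close> at any position \<open>m\<close> contains a word that exceeds a cube of
  period \<open>period n\<close> by \<open>excess n\<close> letters.
\<close>
theorem tribonacci_cubes:
  assumes "y \<in> tribonacci_subshift"
  shows "\<exists>t. m \<le> t \<and> t + int (3 * period n + excess n) \<le> m + int (31 * period n) \<and>
    (\<forall>j. t \<le> j \<longrightarrow> j < t + int (2 * period n + excess n) \<longrightarrow> y (j + int (period n)) = y j)"
proof -
  obtain x :: "nat \<Rightarrow> nat" where x: "arnoux_rauzy 3 x" "has_index_sequence x (\<lambda>n. (n - 1) mod 3 + 1)"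
    and y: "\<And>k. k \<ge> 1 \<Longrightarrow> factors_of_length y k = factors_of_length x k"
    using assms unfolding tribonacci_subshift_def AR_subshift_def two_sided_subshift_def by blast
  have L: "ar_language letters (factors x) trib_index"
    using arnoux_rauzy_language[OF x] by simp
  let ?v = "word_at y m (31 * period n)"
  have "?v \<in> factors_of_length y (31 * period n)"
    unfolding factors_of_length_def by blast
  then have v: "?v \<in> factors x"
    using y[of "31 * period n"] period_pos[of n] unfolding factors_of_length_eq by auto
  obtain B D where BD: "sublist (B @ B @ B @ D) ?v" "prefix D B"
    "length B = period n" "length D = excess n"
    using cube_word[OF L v, of n] by auto
  let ?W = "B @ B @ B @ D"
  obtain a b where ab: "?v = a @ ?W @ b" using BD(1) by (rule sublist_obtain)
  have len: "length ?W = 3 * period n + excess n" using BD by simp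
  define t where "t = m + int (length a)"
  have W: "?W = word_at y t (length ?W)"
    using word_at_split[OF ab] unfolding t_def by simp
  have nth: "y (t + int k) = ?W ! k" if "k < length ?W" for k
    using nth_word_at[OF that, of y t] W by simp
  have "length ?v = length (a @ ?W @ b)" using ab by simp
  then have "length a + length ?W \<le> 31 * period n" by simp
  then have le: "t + int (3 * period n + excess n) \<le> m + int (31 * period n)"
    unfolding t_def len by linarith
  have "y (j + int (period n)) = y j" if j: "t \<le> j" "j < t + int (2 * period n + excess n)" for j
  proof -
    define k where "k = nat (j - t)"
    have k: "j = t + int k" "k < 2 * length B + length D"
      using j BD(3,4) unfolding k_def by auto
    have "y (j + int (period n)) = ?W ! (k + length B)"
      using nth[of "k + length B"] k BD(3,4) by (simp add: ac_simps)
    also have "\<dots> = ?W ! k" by (rule cube_periodic[OF BD(2) k(2)])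
    also have "\<dots> = y j" using nth[of k] k by simp
    finally show ?thesis .
  qed
  then show ?thesis using le by (intro exI[of _ t]) (simp add: t_def)
qed

section \<open>Orbits that meet frequent sets infinitely often\<close>

text \<open>
  On the forward invariant set
  \<open>B\<close> of points whose orbits avoid the limes superior of \<open>G\<close>, the frequency bound and the
  invariance of \<open>M\<close> give \<open>c * measure M B \<le> measure M (B \<inter> G n)\<close> for every \<open>n\<close>. So the
  limes superior of the sets \<open>B \<inter> G n\<close> has at least the measure \<open>c * measure M B\<close>, but it is empty.
\<close>
theorem (in prob_space) AE_orbit_meets_limsup:
  fixes T :: "'a \<Rightarrow> 'a" and G :: "nat \<Rightarrow> 'a set" and N :: "nat \<Rightarrow> nat" and c :: real
  assumes T: "T \<in> M \<rightarrow>\<^sub>M M" and inv: "distr M M T = M"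
    and G: "\<And>n. G n \<in> sets M"
    and c: "c > 0" and N: "\<And>n. N n > 0"
    and freq: "\<And>n x. x \<in> space M \<Longrightarrow> c * real (N n) \<le> real (card {j. j < N n \<and> (T ^^ j) x \<in> G n})"
  shows "AE x in M. \<exists>m. \<exists>\<^sub>\<infinity>n. (T ^^ m) x \<in> G n"
proof -
  have Tj: "T ^^ j \<in> M \<rightarrow>\<^sub>M M" for j
  proof (induction j)
    case (Suc j)
    show ?case using measurable_comp[OF Suc T] by (simp add: o_def)
  qed (simp add: id_def)
  have invj: "distr M M (T ^^ j) = M" for j
  proof (induction j)
    case 0
    show ?case by (simp add: id_def distr_id)
  next
    case (Suc j)
    have "distr M M (T ^^ Suc j) = distr (distr M M (T ^^ j)) M T"
      by (simp add: distr_distr[OF T Tj])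
    then show ?case using Suc inv by (simp add: o_def)
  qed
  define L where "L = (\<Inter>k. \<Union>n\<in>{k..}. G n)"
  have L: "L \<in> sets M" unfolding L_def using G by auto
  have L_iff: "x \<in> L \<longleftrightarrow> (\<exists>\<^sub>\<infinity>n. x \<in> G n)" for x
    unfolding L_def INFM_nat_le by auto
  define B where "B = space M - (\<Union>m. (T ^^ m) -` L \<inter> space M)"
  have B: "B \<in> sets M"
    unfolding B_def using measurable_sets[OF Tj L] by (intro sets.Diff sets.top sets.countable_UN) auto
  have Bspace: "B \<subseteq> space M" unfolding B_def by blast
  have TB: "(T ^^ j) x \<in> B" if "x \<in> B" for x j
  proof -
    have "(T ^^ m) ((T ^^ j) x) \<notin> L" for m
    proof -
      have "(T ^^ (m + j)) x \<notin> L" using that unfolding B_def by blast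
      then show ?thesis by (simp add: funpow_add)
    qed
    then show ?thesis
      using that measurable_space[OF Tj] Bspace unfolding B_def by blast
  qed
  have BL: "B \<inter> L = {}"
  proof (rule ccontr)
    assume "B \<inter> L \<noteq> {}"
    then obtain x where x: "x \<in> B" "x \<in> L" by blast
    then have "x \<in> (T ^^ 0) -` L \<inter> space M" using Bspace by auto
    then show False using x(1) unfolding B_def by blast
  qed
  have lower: "c * measure M B \<le> measure M (B \<inter> G n)" for n
  proof -
    define S where "S j = B \<inter> ((T ^^ j) -` G n \<inter> space M)" for j
    have S: "S j \<in> sets M" for j unfolding S_def using B measurable_sets[OF Tj G] by blast
    \<comment> \<open>Points of \<open>B\<close> stay in \<open>B\<close>, so \<open>S j\<close> lies in the preimage of \<open>B \<inter> G n\<close> under \<open>T ^^ j\<close>.\<close>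
    have Sle: "measure M (S j) \<le> measure M (B \<inter> G n)" for j
    proof -
      have "S j \<subseteq> (T ^^ j) -` (B \<inter> G n) \<inter> space M" unfolding S_def using TB by blast
      then have "measure M (S j) \<le> measure M ((T ^^ j) -` (B \<inter> G n) \<inter> space M)"
        using B G by (intro finite_measure_mono measurable_sets[OF Tj]) auto
      also have "\<dots> = measure (distr M M (T ^^ j)) (B \<inter> G n)"
        using B G by (subst measure_distr[OF Tj]) auto
      finally show ?thesis unfolding invj .
    qed
    have "c * real (N n) * measure M B = (\<integral>x. c * real (N n) * indicator B x \<partial>M)"
      using B Bspace by (simp add: Int_absorb2)
    also have "\<dots> \<le> (\<integral>x. (\<Sum>j<N n. indicator (S j) x) \<partial>M)"
    proof (rule integral_mono)
      show "integrable M (\<lambda>x. c * real (N n) * indicator B x)"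
        using B by (intro integrable_mult_right integrable_real_indicator) (auto simp: emeasure_eq_measure)
      show "integrable M (\<lambda>x. \<Sum>j<N n. indicat_real (S j) x)"
        using S by (intro Bochner_Integration.integrable_sum integrable_real_indicator) (auto simp: emeasure_eq_measure)
      fix x assume x: "x \<in> space M"
      show "c * real (N n) * indicator B x \<le> (\<Sum>j<N n. indicat_real (S j) x)"
      proof (cases "x \<in> B")
        case True
        have "(\<Sum>j<N n. indicat_real (S j) x) = real (card {j \<in> {..<N n}. x \<in> S j})"
          by (simp add: indicator_def sum.If_cases Int_def flip: Collect_conj_eq)
        also have "{j \<in> {..<N n}. x \<in> S j} = {j. j < N n \<and> (T ^^ j) x \<in> G n}"
          unfolding S_def using True x by auto
        finally show ?thesis using freq[OF x, of n] True by simp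
      qed (simp add: sum_nonneg)
    qed
    also have "\<dots> = (\<Sum>j<N n. measure M (S j))"
      using S by (subst Bochner_Integration.integral_sum)
        (auto simp: emeasure_eq_measure Int_absorb2 sets.sets_into_space)
    also have "\<dots> \<le> (\<Sum>j<N n. measure M (B \<inter> G n))" by (intro sum_mono Sle)
    also have "\<dots> = real (N n) * measure M (B \<inter> G n)" by simp
    finally show ?thesis using N[of n] by (simp add: mult_ac)
  qed
  define U where "U k = (\<Union>n\<in>{k..}. B \<inter> G n)" for k
  have U: "U k \<in> sets M" for k unfolding U_def using B G by auto
  have "(\<lambda>k. measure M (U k)) \<longlonglongrightarrow> measure M (\<Inter>k. U k)"
  proof (rule finite_Lim_measure_decseq)
    show "range U \<subseteq> sets M" using U by auto
    show "decseq U" unfolding U_def decseq_def by fastforce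
  qed
  moreover have "(\<Inter>k. U k) = {}" using BL unfolding U_def L_def by auto
  moreover have "c * measure M B \<le> measure M (U k)" for k
    using lower[of k] finite_measure_mono[of "B \<inter> G k" "U k"] U[of k] unfolding U_def by fastforce
  ultimately have "c * measure M B \<le> measure M {}"
    using LIMSEQ_le_const by metis
  then have "measure M B = 0"
    using c measure_nonneg[of M B] by (simp add: mult_le_0_iff)
  then have "AE x in M. x \<notin> B"
    using B by (intro AE_not_in null_setsI) (auto simp: emeasure_eq_measure)
  then show ?thesis
    using AE_space by eventually_elim (auto simp: B_def L_iff)
qed

section \<open>Square-summable sequences\<close>

abbreviation norm2 :: "(int \<Rightarrow> complex) \<Rightarrow> real" where
  "norm2 \<phi> \<equiv> (\<Sum>\<^sub>\<infinity>n. (cmod (\<phi> n))\<^sup>2)"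

lemma ell2_iff: "\<phi> \<in> ell2 \<longleftrightarrow> (\<lambda>n. (cmod (\<phi> n))\<^sup>2) summable_on UNIV"
  by (simp add: ell2_def)

lemma bounded_sums_summable:
  fixes g :: "'a \<Rightarrow> real"
  assumes "\<And>n. 0 \<le> g n" "\<And>F. finite F \<Longrightarrow> sum g F \<le> C"
  shows "g summable_on UNIV" "infsum g UNIV \<le> C"
proof -
  show *: "g summable_on UNIV"
    by (rule nonneg_bdd_above_summable_on) (use assms in \<open>auto intro!: bdd_aboveI[of _ C]\<close>)
  show "infsum g UNIV \<le> C"
    by (rule infsum_le_finite_sums[OF *]) (use assms in auto)
qed

lemma sum_le_norm2:
  assumes "\<phi> \<in> ell2" "finite F"
  shows "(\<Sum>n\<in>F. (cmod (\<phi> n))\<^sup>2) \<le> norm2 \<phi>"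
  using assms unfolding ell2_iff by (intro finite_sum_le_infsum) auto

lemma cmod_le_norm2:
  assumes "\<phi> \<in> ell2"
  shows "(cmod (\<phi> n))\<^sup>2 \<le> norm2 \<phi>"
  using sum_le_norm2[OF assms, of "{n}"] by simp

lemma norm2_nonneg: "0 \<le> norm2 \<phi>"
  by (intro infsum_nonneg) simp

lemma norm2_eq_0:
  assumes "\<phi> \<in> ell2" "norm2 \<phi> \<le> 0"
  shows "\<phi> n = 0"
proof -
  have "(cmod (\<phi> n))\<^sup>2 \<le> 0"
    using cmod_le_norm2[OF assms(1)] assms(2) by (rule order_trans)
  then show ?thesis by simp
qed

lemma cmod_add_sq: "(cmod (a + b))\<^sup>2 \<le> 2 * (cmod a)\<^sup>2 + 2 * (cmod b)\<^sup>2"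
proof -
  have "(cmod (a + b))\<^sup>2 \<le> (cmod a + cmod b)\<^sup>2"
    by (intro power_mono norm_triangle_ineq) simp
  also have "\<dots> \<le> 2 * (cmod a)\<^sup>2 + 2 * (cmod b)\<^sup>2"
    using sum_squares_bound[of "cmod a" "cmod b"] by (simp add: power2_sum)
  finally show ?thesis .
qed

lemma ell2_dominated:
  assumes "g summable_on UNIV" "\<And>n. (cmod (\<phi> n))\<^sup>2 \<le> g n"
  shows "\<phi> \<in> ell2" "norm2 \<phi> \<le> infsum g UNIV"
proof -
  show *: "\<phi> \<in> ell2"
    unfolding ell2_iff by (rule summable_on_comparison_test[OF assms(1)]) (use assms in auto)
  show "norm2 \<phi> \<le> infsum g UNIV"
    by (rule infsum_mono) (use * assms in \<open>auto simp: ell2_iff\<close>)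
qed

lemma ell2_add: "\<phi> \<in> ell2 \<Longrightarrow> \<psi> \<in> ell2 \<Longrightarrow> (\<lambda>n. \<phi> n + \<psi> n) \<in> ell2"
  and norm2_add_le: "\<phi> \<in> ell2 \<Longrightarrow> \<psi> \<in> ell2 \<Longrightarrow> norm2 (\<lambda>n. \<phi> n + \<psi> n) \<le> 2 * norm2 \<phi> + 2 * norm2 \<psi>"
proof -
  assume *: "\<phi> \<in> ell2" "\<psi> \<in> ell2"
  let ?g = "\<lambda>n. 2 * (cmod (\<phi> n))\<^sup>2 + 2 * (cmod (\<psi> n))\<^sup>2"
  have s: "?g summable_on UNIV"
    using * unfolding ell2_iff by (intro summable_on_add summable_on_cmult_right)
  have "infsum ?g UNIV = 2 * norm2 \<phi> + 2 * norm2 \<psi>"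
    using * unfolding ell2_iff
    by (subst infsum_add) (auto intro!: summable_on_cmult_right simp: infsum_cmult_right')
  then show "(\<lambda>n. \<phi> n + \<psi> n) \<in> ell2" "norm2 (\<lambda>n. \<phi> n + \<psi> n) \<le> 2 * norm2 \<phi> + 2 * norm2 \<psi>"
    using ell2_dominated[OF s, of "\<lambda>n. \<phi> n + \<psi> n"] cmod_add_sq by auto
qed

lemma norm2_scale: "norm2 (\<lambda>n. c * \<phi> n) = (cmod c)\<^sup>2 * norm2 \<phi>"
  by (simp add: norm_mult power_mult_distrib infsum_cmult_right')

lemma ell2_scale: "\<phi> \<in> ell2 \<Longrightarrow> (\<lambda>n. c * \<phi> n) \<in> ell2"
  unfolding ell2_iff norm_mult power_mult_distrib by (rule summable_on_cmult_right)

lemma ell2_diff: "\<phi> \<in> ell2 \<Longrightarrow> \<psi> \<in> ell2 \<Longrightarrow> (\<lambda>n. \<phi> n - \<psi> n) \<in> ell2"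
  using ell2_add[of \<phi> "\<lambda>n. (-1) * \<psi> n"] ell2_scale[of \<psi> "-1"] by simp

lemma bij_plus: "bij (\<lambda>n::int. n + k)"
  by (rule bij_plus_right)

lemma ell2_shift: "\<phi> \<in> ell2 \<Longrightarrow> (\<lambda>n. \<phi> (n + k)) \<in> ell2"
  unfolding ell2_iff
  using summable_on_reindex_bij_betw[OF bij_plus, of "\<lambda>n. (cmod (\<phi> n))\<^sup>2" k] by simp

lemma norm2_shift: "norm2 (\<lambda>n. \<phi> (n + k)) = norm2 \<phi>"
  using infsum_reindex_bij_betw[OF bij_plus, of "\<lambda>n. (cmod (\<phi> n))\<^sup>2" k] by simp

text \<open>Fatou's lemma for the counting measure.\<close>
lemma norm2_limit:
  assumes "\<And>k. \<psi> k \<in> ell2" "\<And>k. norm2 (\<psi> k) \<le> C" "\<And>n. (\<lambda>k. \<psi> k n) \<longlonglongrightarrow> \<eta> n"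
  shows "\<eta> \<in> ell2" "norm2 \<eta> \<le> C"
proof -
  have "(\<Sum>n\<in>F. (cmod (\<eta> n))\<^sup>2) \<le> C" if "finite F" for F
  proof (rule LIMSEQ_le_const2)
    show "(\<lambda>k. \<Sum>n\<in>F. (cmod (\<psi> k n))\<^sup>2) \<longlonglongrightarrow> (\<Sum>n\<in>F. (cmod (\<eta> n))\<^sup>2)"
      by (intro tendsto_intros assms(3))
    show "\<exists>N. \<forall>k\<ge>N. (\<Sum>n\<in>F. (cmod (\<psi> k n))\<^sup>2) \<le> C"
      using sum_le_norm2[OF assms(1) that] assms(2) order_trans by blast
  qed
  then show "\<eta> \<in> ell2" "norm2 \<eta> \<le> C"
    unfolding ell2_iff using bounded_sums_summable[of "\<lambda>n. (cmod (\<eta> n))\<^sup>2" C] by auto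
qed

lemma ell2_tendsto_0:
  assumes "\<phi> \<in> ell2"
  shows "(\<phi> \<longlongrightarrow> 0) cofinite"
proof -
  have "finite {n. e \<le> cmod (\<phi> n)}" if "e > 0" for e
  proof (rule ccontr)
    assume inf: "infinite {n. e \<le> cmod (\<phi> n)}"
    have "0 < e\<^sup>2" using \<open>e > 0\<close> by simp
    then obtain N :: nat where N: "norm2 \<phi> < real N * e\<^sup>2"
      using ex_less_of_nat_mult[of "e\<^sup>2" "norm2 \<phi>"] by auto
    obtain F where F: "finite F" "card F = N" "F \<subseteq> {n. e \<le> cmod (\<phi> n)}"
      using infinite_arbitrarily_large[OF inf] by blast
    have "real N * e\<^sup>2 = (\<Sum>n\<in>F. e\<^sup>2)" using F by simp
    also have "\<dots> \<le> (\<Sum>n\<in>F. (cmod (\<phi> n))\<^sup>2)"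
      using F that by (intro sum_mono power_mono) auto
    also have "\<dots> \<le> norm2 \<phi>" by (rule sum_le_norm2[OF assms F(1)])
    finally show False using N by simp
  qed
  then show ?thesis
    unfolding tendsto_iff eventually_cofinite by (simp add: not_less)
qed

lemma abs_prod_summable:
  assumes "\<phi> \<in> ell2" "\<psi> \<in> ell2"
  shows "(\<lambda>n. norm (\<phi> n * \<psi> n)) summable_on UNIV"
proof (rule summable_on_comparison_test)
  show "(\<lambda>n. (cmod (\<phi> n))\<^sup>2 + (cmod (\<psi> n))\<^sup>2) summable_on UNIV"
    using assms unfolding ell2_iff by (rule summable_on_add)
  show "norm (\<phi> n * \<psi> n) \<le> (cmod (\<phi> n))\<^sup>2 + (cmod (\<psi> n))\<^sup>2" for n
    using sum_squares_bound[of "cmod (\<phi> n)" "cmod (\<psi> n)"]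
      mult_nonneg_nonneg[of "cmod (\<phi> n)" "cmod (\<psi> n)"]
    by (simp add: norm_mult del: mult_nonneg_nonneg)
qed simp

lemma ell2_cnj: "\<phi> \<in> ell2 \<Longrightarrow> (\<lambda>n. cnj (\<phi> n)) \<in> ell2"
  by (simp add: ell2_iff)

lemma inner_summable:
  assumes "\<phi> \<in> ell2" "\<psi> \<in> ell2"
  shows "(\<lambda>n. cnj (\<phi> n) * \<psi> n) summable_on UNIV"
  by (rule abs_summable_summable[OF abs_prod_summable[OF ell2_cnj[OF assms(1)] assms(2)]])

text \<open>
  If \<open>x\<close> and \<open>y\<close> run through the components of \<open>\<phi>\<close> and of \<open>A \<phi>\<close> for a symmetric \<open>A\<close>, the last
  terms add up to \<open>0\<close>, and this becomes Pythagoras' theorem (\<open>norm2_combination\<close>).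
\<close>
lemma cmod_rotated_sum:
  "(cmod (complex_of_real a * x + \<i> * complex_of_real b * y))\<^sup>2 =
    a\<^sup>2 * (cmod x)\<^sup>2 + b\<^sup>2 * (cmod y)\<^sup>2 + (- 2 * a * b) * Im (cnj x * y)"
proof -
  have "Re (complex_of_real a * x + \<i> * complex_of_real b * y) = a * Re x - b * Im y"
    "Im (complex_of_real a * x + \<i> * complex_of_real b * y) = a * Im x + b * Re y"
    by simp_all
  then show ?thesis
    unfolding cmod_power2 by (simp add: power2_eq_square algebra_simps)
qed

text \<open>
  A bounded sequence that tends to \<open>0\<close> pointwise tends to \<open>0\<close> weakly: outside a finite set \<open>F\<close> that
  carries nearly all of \<open>\<phi>\<close>, the products are bounded by \<open>\<bar>\<phi>\<bar>\<^sup>2 / d + d * \<bar>\<psi>\<bar>\<^sup>2\<close> with a small \<open>d\<close>.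
\<close>
lemma inner_tendsto_0:
  assumes "\<phi> \<in> ell2" "\<And>k. \<psi> k \<in> ell2" "\<And>k. norm2 (\<psi> k) \<le> M" "\<And>n. (\<lambda>k. \<psi> k n) \<longlonglongrightarrow> 0"
  shows "(\<lambda>k. ell2_inner \<phi> (\<psi> k)) \<longlonglongrightarrow> 0"
proof (rule LIMSEQ_I)
  fix e :: real assume e: "e > 0"
  have M: "0 \<le> M" using norm2_nonneg[of "\<psi> 0"] assms(3)[of 0] by linarith
  \<comment> \<open>The denominator is \<open>M + 1\<close> rather than \<open>M\<close> because \<open>M\<close> may be \<open>0\<close>.\<close>
  define d where "d = e / (3 * (M + 1))"
  have d: "d > 0" "d * M < e / 3"
    using e M unfolding d_def by (simp_all add: field_simps)
  have "((\<lambda>n. (cmod (\<phi> n))\<^sup>2) has_sum norm2 \<phi>) UNIV"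
    using assms(1) by (simp add: ell2_iff)
  then have "(sum (\<lambda>n. (cmod (\<phi> n))\<^sup>2) \<longlongrightarrow> norm2 \<phi>) (finite_subsets_at_top UNIV)"
    by (simp add: has_sum_def)
  then have "eventually (\<lambda>F. norm2 \<phi> - d * e / 3 < (\<Sum>n\<in>F. (cmod (\<phi> n))\<^sup>2)) (finite_subsets_at_top UNIV)"
    by (rule order_tendstoD(1)) (use d(1) e in simp)
  then obtain F where F: "finite F" "norm2 \<phi> - d * e / 3 < (\<Sum>n\<in>F. (cmod (\<phi> n))\<^sup>2)"
    unfolding eventually_finite_subsets_at_top by blast
  have split: "infsum g UNIV = sum g F + infsum g (- F)" if "g summable_on UNIV" for g :: "int \<Rightarrow> real"
    using infsum_Un_disjoint[of g F "- F"] F(1) that summable_on_subset[OF that] by simp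
  have tail: "(\<Sum>\<^sub>\<infinity>n\<in>-F. (cmod (\<phi> n))\<^sup>2) < d * e / 3"
    using split[of "\<lambda>n. (cmod (\<phi> n))\<^sup>2"] assms(1) F(2) by (simp add: ell2_iff)
  have "(\<lambda>k. \<Sum>n\<in>F. cmod (cnj (\<phi> n) * \<psi> k n)) \<longlonglongrightarrow> (\<Sum>n\<in>F. cmod (cnj (\<phi> n) * 0))"
    by (intro tendsto_intros assms(4))
  then have "(\<lambda>k. \<Sum>n\<in>F. cmod (cnj (\<phi> n) * \<psi> k n)) \<longlonglongrightarrow> 0" by simp
  then have "eventually (\<lambda>k. (\<Sum>n\<in>F. cmod (cnj (\<phi> n) * \<psi> k n)) < e / 3) sequentially"
    by (rule order_tendstoD(2)) (use e in simp)
  then obtain N where N: "\<And>k. k \<ge> N \<Longrightarrow> (\<Sum>n\<in>F. cmod (cnj (\<phi> n) * \<psi> k n)) < e / 3"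
    unfolding eventually_sequentially by blast
  have "norm (ell2_inner \<phi> (\<psi> k) - 0) < e" if k: "k \<ge> N" for k
  proof -
    have abs: "(\<lambda>n. norm (cnj (\<phi> n) * \<psi> k n)) summable_on UNIV"
      by (rule abs_prod_summable[OF ell2_cnj[OF assms(1)] assms(2)])
    have am: "norm (cnj (\<phi> n) * \<psi> k n) \<le> (1 / d) * (cmod (\<phi> n))\<^sup>2 + d * (cmod (\<psi> k n))\<^sup>2" for n
    proof -
      let ?x = "cmod (\<phi> n)" and ?y = "cmod (\<psi> k n)"
      have "0 \<le> (?x - d * ?y)\<^sup>2 + ?x\<^sup>2 + (d * ?y)\<^sup>2" by simp
      then have "2 * (d * (?x * ?y)) \<le> 2 * (?x\<^sup>2 + d * (d * ?y\<^sup>2))"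
        by (simp add: power2_eq_square algebra_simps)
      then have "?x * ?y \<le> (?x\<^sup>2 + d * (d * ?y\<^sup>2)) / d"
        using d by (simp add: field_simps)
      also have "\<dots> = (1 / d) * ?x\<^sup>2 + d * ?y\<^sup>2"
        using d by (simp add: field_simps)
      finally show ?thesis by (simp add: norm_mult)
    qed
    have s1: "(\<lambda>n. (1 / d) * (cmod (\<phi> n))\<^sup>2) summable_on - F"
      using assms(1) unfolding ell2_iff
      by (intro summable_on_cmult_right) (rule summable_on_subset, auto)
    have s2: "(\<lambda>n. d * (cmod (\<psi> k n))\<^sup>2) summable_on - F"
      using assms(2) unfolding ell2_iff
      by (intro summable_on_cmult_right) (rule summable_on_subset, auto)
    have "(\<Sum>\<^sub>\<infinity>n\<in>-F. norm (cnj (\<phi> n) * \<psi> k n)) \<le>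
        (\<Sum>\<^sub>\<infinity>n\<in>-F. (1 / d) * (cmod (\<phi> n))\<^sup>2 + d * (cmod (\<psi> k n))\<^sup>2)"
      by (rule infsum_mono[OF summable_on_subset[OF abs] summable_on_add[OF s1 s2] am]) auto
    also have "\<dots> = (1 / d) * (\<Sum>\<^sub>\<infinity>n\<in>-F. (cmod (\<phi> n))\<^sup>2) + d * (\<Sum>\<^sub>\<infinity>n\<in>-F. (cmod (\<psi> k n))\<^sup>2)"
      by (subst infsum_add[OF s1 s2]) (simp only: infsum_cmult_right')
    also have "\<dots> \<le> (1 / d) * (d * e / 3) + d * M"
    proof (intro add_mono mult_left_mono)
      have "(\<Sum>\<^sub>\<infinity>n\<in>-F. (cmod (\<psi> k n))\<^sup>2) \<le> norm2 (\<psi> k)"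
        using split[of "\<lambda>n. (cmod (\<psi> k n))\<^sup>2"] assms(2) by (simp add: ell2_iff sum_nonneg)
      then show "(\<Sum>\<^sub>\<infinity>n\<in>-F. (cmod (\<psi> k n))\<^sup>2) \<le> M" using assms(3)[of k] by simp
    qed (use tail d in auto)
    also have "\<dots> < 2 * e / 3" using d by simp
    finally have "(\<Sum>\<^sub>\<infinity>n. norm (cnj (\<phi> n) * \<psi> k n)) < e"
      using split[OF abs] N[OF k] by simp
    moreover have "norm (ell2_inner \<phi> (\<psi> k)) \<le> (\<Sum>\<^sub>\<infinity>n. norm (cnj (\<phi> n) * \<psi> k n))"
      unfolding ell2_inner_def by (rule norm_infsum_bound[OF abs])
    ultimately show ?thesis by simp
  qed
  then show "\<exists>N. \<forall>k\<ge>N. norm (ell2_inner \<phi> (\<psi> k) - 0) < e" by blast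
qed

text \<open>By Tychonoff's theorem, as the product topology on \<open>int \<Rightarrow> complex\<close> is first countable.\<close>
lemma pointwise_convergent_subsequence:
  fixes \<psi> :: "nat \<Rightarrow> int \<Rightarrow> complex"
  assumes "\<And>k n. cmod (\<psi> k n) \<le> C"
  shows "\<exists>\<eta> r. strict_mono r \<and> (\<forall>n. (\<lambda>k. \<psi> (r k) n) \<longlonglongrightarrow> \<eta> n)"
proof -
  let ?S = "PiE UNIV (\<lambda>_::int. cball (0::complex) C)"
  have "compactin (product_topology (\<lambda>_. euclidean) UNIV) ?S"
    unfolding compactin_PiE by (simp add: compactin_euclidean_iff)
  then have "compact ?S"
    by (simp add: euclidean_product_topology compactin_euclidean_iff)
  then have "seq_compact ?S" by (rule compact_imp_seq_compact)
  moreover have "\<forall>k. \<psi> k \<in> ?S" using assms by (simp add: PiE_iff)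
  ultimately obtain \<eta> r where "\<eta> \<in> ?S" and r: "strict_mono r" "(\<psi> \<circ> r) \<longlonglongrightarrow> \<eta>"
    by (rule seq_compactE)
  have "(\<lambda>k. \<psi> (r k) n) \<longlonglongrightarrow> \<eta> n" for n
  proof -
    have "\<forall>g\<in>UNIV. isCont (\<lambda>f :: int \<Rightarrow> complex. f n) g"
      by (rule continuous_on_eq_continuous_at[THEN iffD1, OF open_UNIV continuous_on_product_coordinates])
    then have "isCont (\<lambda>f :: int \<Rightarrow> complex. f n) \<eta>" by simp
    then show ?thesis
      using isCont_tendsto_compose[OF _ r(2)] by (simp add: o_def)
  qed
  then show ?thesis using r(1) by blast
qed

section \<open>Schroedinger operators and their point spectrum\<close>

locale schrodinger =
  fixes V :: "int \<Rightarrow> real" and K :: real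
  assumes bounded: "\<bar>V n\<bar> \<le> K"
begin

definition H :: seq_operator where
  "H \<phi> = (\<lambda>n. \<phi> (n + 1) + \<phi> (n - 1) + complex_of_real (V n) * \<phi> n)"

lemma H_diff: "H (\<lambda>n. \<phi> n - \<psi> n) = (\<lambda>n. H \<phi> n - H \<psi> n)"
  by (simp add: H_def algebra_simps)

lemma H_scale: "H (\<lambda>n. c * \<phi> n) = (\<lambda>n. c * H \<phi> n)"
  by (simp add: H_def algebra_simps)

lemma H_bounded:
  assumes "\<phi> \<in> ell2"
  shows "H \<phi> \<in> ell2" "norm2 (H \<phi>) \<le> (8 + 2 * K\<^sup>2) * norm2 \<phi>"
proof -
  have sh: "(\<lambda>n. \<phi> (n - 1)) \<in> ell2" "norm2 (\<lambda>n. \<phi> (n - 1)) = norm2 \<phi>"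
    using ell2_shift[OF assms, of "-1"] norm2_shift[of \<phi> "-1"] by simp_all
  have s: "(\<lambda>n. \<phi> (n + 1) + \<phi> (n - 1)) \<in> ell2"
    "norm2 (\<lambda>n. \<phi> (n + 1) + \<phi> (n - 1)) \<le> 4 * norm2 \<phi>"
    using ell2_add[OF ell2_shift[OF assms, of 1] sh(1)]
      norm2_add_le[OF ell2_shift[OF assms, of 1] sh(1)] norm2_shift[of \<phi> 1] sh(2) by simp_all
  have "(cmod (complex_of_real (V n) * \<phi> n))\<^sup>2 \<le> K\<^sup>2 * (cmod (\<phi> n))\<^sup>2" for n
    using power_mono[OF bounded[of n], of 2]
    by (simp add: norm_mult power_mult_distrib mult_right_mono)
  moreover have "(\<lambda>n. K\<^sup>2 * (cmod (\<phi> n))\<^sup>2) summable_on UNIV"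
    using assms unfolding ell2_iff by (rule summable_on_cmult_right)
  ultimately have v: "(\<lambda>n. complex_of_real (V n) * \<phi> n) \<in> ell2"
    "norm2 (\<lambda>n. complex_of_real (V n) * \<phi> n) \<le> K\<^sup>2 * norm2 \<phi>"
    using ell2_dominated[of "\<lambda>n. K\<^sup>2 * (cmod (\<phi> n))\<^sup>2" "\<lambda>n. complex_of_real (V n) * \<phi> n"]
    by (auto simp: infsum_cmult_right')
  show "H \<phi> \<in> ell2"
    unfolding H_def by (rule ell2_add[OF s(1) v(1)])
  show "norm2 (H \<phi>) \<le> (8 + 2 * K\<^sup>2) * norm2 \<phi>"
    unfolding H_def using norm2_add_le[OF s(1) v(1)] s(2) v(2) by (simp add: algebra_simps)
qed

text \<open>
  Symmetry of \<open>H\<close>. The potential is real and does not contribute; the two shifts contribute the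
  difference of the current \<open>Im (cnj (\<phi> n) * \<phi> (n + 1))\<close> at neighbouring sites, so the sum
  telescopes.
\<close>
lemma flux_sum:
  assumes "\<phi> \<in> ell2"
  shows "((\<lambda>n. Im (cnj (\<phi> n) * H \<phi> n)) has_sum 0) UNIV"
proof -
  define J where "J n = Im (cnj (\<phi> n) * \<phi> (n + 1))" for n
  have sJ: "J summable_on UNIV"
    unfolding J_def by (intro summable_on_Im inner_summable assms ell2_shift)
  then have J: "(J has_sum infsum J UNIV) UNIV" by simp
  then have "((\<lambda>n. J (n + (-1))) has_sum infsum J UNIV) UNIV"
    using has_sum_reindex_bij_betw[OF bij_plus, of J "-1"] by blast
  then have "((\<lambda>n. J n - J (n - 1)) has_sum 0) UNIV"
    using has_sum_add[OF J, of "\<lambda>n. - J (n - 1)" "- infsum J UNIV"]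
    by (simp add: has_sum_uminus)
  moreover have "Im (cnj (\<phi> n) * H \<phi> n) = J n - J (n - 1)" for n
    unfolding J_def H_def by (simp add: algebra_simps)
  ultimately show ?thesis by simp
qed

lemma norm2_combination:
  fixes a b t :: real
  assumes "\<phi> \<in> ell2"
  shows "norm2 (\<lambda>n. complex_of_real a * \<phi> n + \<i> * complex_of_real b * (H \<phi> n - complex_of_real t * \<phi> n)) =
    a\<^sup>2 * norm2 \<phi> + b\<^sup>2 * norm2 (\<lambda>n. H \<phi> n - complex_of_real t * \<phi> n)"
proof -
  define \<eta> where "\<eta> = (\<lambda>n. H \<phi> n - complex_of_real t * \<phi> n)"
  have eta: "\<eta> \<in> ell2"
    unfolding \<eta>_def by (rule ell2_diff[OF H_bounded(1)[OF assms] ell2_scale[OF assms]])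
  have pt: "(cmod (complex_of_real a * \<phi> n + \<i> * complex_of_real b * \<eta> n))\<^sup>2 =
      a\<^sup>2 * (cmod (\<phi> n))\<^sup>2 + b\<^sup>2 * (cmod (\<eta> n))\<^sup>2 + (- 2 * a * b) * Im (cnj (\<phi> n) * H \<phi> n)" for n
  proof -
    have "Im (cnj (\<phi> n) * H \<phi> n) = Im (cnj (\<phi> n) * \<eta> n)"
      unfolding \<eta>_def by (simp add: right_diff_distrib)
    then show ?thesis by (simp only: cmod_rotated_sum)
  qed
  have "((\<lambda>n. (cmod (complex_of_real a * \<phi> n + \<i> * complex_of_real b * \<eta> n))\<^sup>2) has_sum
      (a\<^sup>2 * norm2 \<phi> + b\<^sup>2 * norm2 \<eta> + (- 2 * a * b) * 0)) UNIV"
    unfolding pt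
    by (rule has_sum_add[OF has_sum_add[OF has_sum_cmult_right has_sum_cmult_right]
          has_sum_cmult_right[OF flux_sum[OF assms]]])
      (use assms eta in \<open>simp_all add: ell2_iff\<close>)
  then have "norm2 (\<lambda>n. complex_of_real a * \<phi> n + \<i> * complex_of_real b * \<eta> n) =
      a\<^sup>2 * norm2 \<phi> + b\<^sup>2 * norm2 \<eta>"
    using infsumI by fastforce
  then show ?thesis
    unfolding \<eta>_def .
qed

end

context schrodinger
begin

lemma minus_scalar_diff:
  "minus_scalar H z (\<lambda>n. \<phi> n - \<psi> n) = (\<lambda>n. minus_scalar H z \<phi> n - minus_scalar H z \<psi> n)"
  unfolding minus_scalar_def H_diff by (simp add: algebra_simps)

lemma minus_scalar_in_ell2: "\<phi> \<in> ell2 \<Longrightarrow> minus_scalar H z \<phi> \<in> ell2"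
  unfolding minus_scalar_def by (rule ell2_diff[OF H_bounded(1) ell2_scale])

lemma norm2_minus_scalar:
  assumes "\<phi> \<in> ell2"
  shows "(Im z)\<^sup>2 * norm2 \<phi> \<le> norm2 (minus_scalar H z \<phi>)"
proof -
  have "minus_scalar H z \<phi> = (\<lambda>n. (- \<i>) * (complex_of_real (Im z) * \<phi> n +
      \<i> * complex_of_real 1 * (H \<phi> n - complex_of_real (Re z) * \<phi> n)))"
    unfolding minus_scalar_def by (subst complex_eq[of z]) (simp add: algebra_simps)
  then have "norm2 (minus_scalar H z \<phi>) = (Im z)\<^sup>2 * norm2 \<phi> +
      1\<^sup>2 * norm2 (\<lambda>n. H \<phi> n - complex_of_real (Re z) * \<phi> n)"
    using norm2_combination[OF assms, of "Im z" 1 "Re z"] norm2_scale by simp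
  then show ?thesis
    using norm2_nonneg[of "\<lambda>n. H \<phi> n - complex_of_real (Re z) * \<phi> n"] by simp
qed

lemma minus_scalar_inj: "Im z \<noteq> 0 \<Longrightarrow> inj_on (minus_scalar H z) ell2"
proof (rule inj_onI)
  fix \<phi> \<psi> assume *: "Im z \<noteq> 0" "\<phi> \<in> ell2" "\<psi> \<in> ell2" "minus_scalar H z \<phi> = minus_scalar H z \<psi>"
  define \<delta> where "\<delta> = (\<lambda>n. \<phi> n - \<psi> n)"
  have d: "\<delta> \<in> ell2" unfolding \<delta>_def using * by (intro ell2_diff)
  have "minus_scalar H z \<delta> = (\<lambda>n. 0)"
    unfolding \<delta>_def minus_scalar_diff * by simp
  then have "(Im z)\<^sup>2 * norm2 \<delta> \<le> 0"
    using norm2_minus_scalar[OF d, of z] by simp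
  then have "norm2 \<delta> \<le> 0"
    using *(1) by (simp add: mult_le_0_iff)
  then have "\<delta> n = 0" for n by (rule norm2_eq_0[OF d])
  then show "\<phi> = \<psi>" unfolding \<delta>_def by auto
qed

text \<open>
  The solution is a fixed point of \<open>T \<psi> = \<psi> - \<i> s ((H - z) \<psi> - \<phi>)\<close>. For small \<open>s\<close> this
  is a contraction, since the imaginary part of \<open>z\<close> shrinks \<open>\<psi>\<close> to first order in \<open>s\<close>, while
  the self-adjoint part of \<open>H - z\<close> acts at a right angle and changes the squared norm to second
  order only.
\<close>
lemma minus_scalar_surj:
  assumes "\<phi> \<in> ell2" "Im z > 0"
  shows "\<exists>\<psi>\<in>ell2. minus_scalar H z \<psi> = \<phi>"
proof -
  define t e where "t = Re z" and "e = Im z"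
  define C where "C = 2 * (8 + 2 * K\<^sup>2) + 2 * t\<^sup>2"
  \<comment> \<open>\<open>T\<close> multiplies squared distances by at most \<open>(1 - s * e)\<^sup>2 + s\<^sup>2 * C\<close>. This choice of \<open>s\<close>
      minimizes it and makes it equal to \<open>1 - s * e\<close>.\<close>
  define s where "s = e / (e\<^sup>2 + C)"
  define T where "T \<psi> = (\<lambda>n. \<psi> n - \<i> * complex_of_real s * (minus_scalar H z \<psi> n - \<phi> n))" for \<psi>
  have e: "e > 0" using assms(2) unfolding e_def .
  have C: "C > 0" unfolding C_def by (simp add: add_pos_nonneg)
  have eC: "e\<^sup>2 + C > 0" using C by (simp add: add_nonneg_pos)
  have s: "s > 0" "s * (e\<^sup>2 + C) = e" using e eC unfolding s_def by simp_all
  have Tin: "T \<psi> \<in> ell2" if "\<psi> \<in> ell2" for \<psi>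
    unfolding T_def
    by (rule ell2_diff[OF that ell2_scale[OF ell2_diff[OF minus_scalar_in_ell2[OF that] assms(1)]]])
  have contr: "norm2 (\<lambda>n. T \<psi> n - T \<psi>' n) \<le> (1 - s * e) * norm2 (\<lambda>n. \<psi> n - \<psi>' n)"
    if "\<psi> \<in> ell2" "\<psi>' \<in> ell2" for \<psi> \<psi>'
  proof -
    define \<delta> where "\<delta> = (\<lambda>n. \<psi> n - \<psi>' n)"
    have d: "\<delta> \<in> ell2" unfolding \<delta>_def using that by (rule ell2_diff)
    have "T \<psi> n - T \<psi>' n = \<delta> n - \<i> * complex_of_real s * minus_scalar H z \<delta> n" for n
      unfolding \<delta>_def minus_scalar_diff T_def by (simp add: algebra_simps)
    moreover have "minus_scalar H z \<delta> n = (H \<delta> n - complex_of_real t * \<delta> n) - \<i> * complex_of_real e * \<delta> n" for n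
      unfolding minus_scalar_def t_def e_def by (subst complex_eq[of z]) (simp add: algebra_simps)
    ultimately have "T \<psi> n - T \<psi>' n = complex_of_real (1 - s * e) * \<delta> n +
        \<i> * complex_of_real (- s) * (H \<delta> n - complex_of_real t * \<delta> n)" for n
      by (simp add: algebra_simps)
    then have "norm2 (\<lambda>n. T \<psi> n - T \<psi>' n) =
        (1 - s * e)\<^sup>2 * norm2 \<delta> + (- s)\<^sup>2 * norm2 (\<lambda>n. H \<delta> n - complex_of_real t * \<delta> n)"
      using norm2_combination[OF d, of "1 - s * e" "- s" t] by simp
    also have "\<dots> \<le> (1 - s * e)\<^sup>2 * norm2 \<delta> + s\<^sup>2 * (C * norm2 \<delta>)"
    proof -
      have "norm2 (\<lambda>n. H \<delta> n + complex_of_real (- t) * \<delta> n) \<le>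
          2 * norm2 (H \<delta>) + 2 * norm2 (\<lambda>n. complex_of_real (- t) * \<delta> n)"
        by (rule norm2_add_le[OF H_bounded(1)[OF d] ell2_scale[OF d]])
      also have "\<dots> \<le> C * norm2 \<delta>"
        using H_bounded(2)[OF d] unfolding norm2_scale C_def by (simp add: algebra_simps)
      finally show ?thesis
        by (intro add_left_mono) (simp add: mult_left_mono)
    qed
    also have "\<dots> = (1 - s * e) * norm2 \<delta>"
    proof -
      have "(1 - s * e)\<^sup>2 + s\<^sup>2 * C = 1 - 2 * (s * e) + s * (s * (e\<^sup>2 + C))"
        by (simp add: power2_eq_square algebra_simps)
      also have "\<dots> = 1 - s * e" unfolding s(2) by simp
      finally show ?thesis by (simp flip: distrib_right mult.assoc)
    qed
    finally show ?thesis unfolding \<delta>_def .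
  qed
  define it where "it k = (T ^^ k) (\<lambda>n. 0)" for k
  have it_Suc: "it (Suc k) = T (it k)" for k unfolding it_def by simp
  have it: "it k \<in> ell2" for k
  proof (induction k)
    case 0 then show ?case by (simp add: it_def ell2_iff)
  qed (simp add: it_Suc Tin)
  define q where "q = 1 - s * e"
  define D where "D = norm2 (\<lambda>n. it (Suc 0) n - it 0 n)"
  have q1: "q < 1" unfolding q_def using s e by simp
  have q0: "0 \<le> q"
  proof -
    have "e * e \<le> e\<^sup>2 + C" using C by (simp add: power2_eq_square)
    then have "s * e \<le> 1" unfolding s_def using eC by (simp add: divide_le_eq_1)
    then show ?thesis unfolding q_def by simp
  qed
  have step: "norm2 (\<lambda>n. it (Suc k) n - it k n) \<le> q ^ k * D" for k
  proof (induction k)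
    case (Suc k)
    have "norm2 (\<lambda>n. it (Suc (Suc k)) n - it (Suc k) n) \<le> q * norm2 (\<lambda>n. it (Suc k) n - it k n)"
      using contr[OF it[of "Suc k"] it[of k]] unfolding it_Suc q_def .
    also have "\<dots> \<le> q * (q ^ k * D)" using Suc q0 by (rule mult_left_mono)
    finally show ?case by simp
  qed (simp add: D_def)
  have D0: "0 \<le> D" unfolding D_def by (rule norm2_nonneg)
  have "\<exists>l. (\<lambda>k. it k n) \<longlonglongrightarrow> l" for n
  proof -
    have "cmod (it (Suc k) n - it k n) \<le> sqrt q ^ k * sqrt D" for k
    proof (rule power2_le_imp_le)
      have "(cmod (it (Suc k) n - it k n))\<^sup>2 \<le> q ^ k * D"
        using cmod_le_norm2[OF ell2_diff[OF it[of "Suc k"] it[of k]], of n] step[of k] by simp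
      also have "\<dots> = (sqrt q ^ k * sqrt D)\<^sup>2"
        using q0 D0 by (simp add: power_mult_distrib power_commuting_commutes flip: power_mult)
          (metis mult.commute power_mult real_sqrt_pow2)
      finally show "(cmod (it (Suc k) n - it k n))\<^sup>2 \<le> (sqrt q ^ k * sqrt D)\<^sup>2" .
    qed (use q0 D0 in simp)
    moreover have "summable (\<lambda>k. sqrt q ^ k * sqrt D)"
      using q0 q1 by (intro summable_mult2 summable_geometric) simp
    ultimately have "summable (\<lambda>k. it (Suc k) n - it k n)"
      by (intro summable_comparison_test[of "\<lambda>k. it (Suc k) n - it k n"]) auto
    then have "(\<lambda>k. \<Sum>j<k. it (Suc j) n - it j n) \<longlonglongrightarrow> (\<Sum>j. it (Suc j) n - it j n)"
      by (rule summable_LIMSEQ)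
    then have "(\<lambda>k. it k n - it 0 n) \<longlonglongrightarrow> (\<Sum>j. it (Suc j) n - it j n)"
      unfolding sum_lessThan_telescope[of "\<lambda>k. it k n"] .
    then show ?thesis by (auto simp: it_def)
  qed
  then obtain \<psi> where lim: "\<And>n. (\<lambda>k. it k n) \<longlonglongrightarrow> \<psi> n" by metis
  have res: "minus_scalar H z (it k) n = \<phi> n + (\<i> / complex_of_real s) * (it (Suc k) n - it k n)" for k n
  proof -
    have "it (Suc k) n - it k n = - \<i> * complex_of_real s * (minus_scalar H z (it k) n - \<phi> n)"
      unfolding it_Suc T_def by simp
    then show ?thesis using s(1) by (simp del: right_diff_distrib right_diff_distrib_numeral)
  qed
  \<comment> \<open>The iterates are bounded because their images under \<open>H - z\<close> are: these differ from \<open>\<phi>\<close> by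
      a multiple of the last increment.\<close>
  define B where "B = (2 * norm2 \<phi> + 2 * ((1 / s)\<^sup>2 * D)) / e\<^sup>2"
  have "norm2 (it k) \<le> B" for k
  proof -
    have eq: "minus_scalar H z (it k) = (\<lambda>n. \<phi> n + (\<i> / complex_of_real s) * (it (Suc k) n - it k n))"
      using res by auto
    have "norm2 (minus_scalar H z (it k)) \<le> 2 * norm2 \<phi> +
        2 * norm2 (\<lambda>n. (\<i> / complex_of_real s) * (it (Suc k) n - it k n))"
      unfolding eq by (rule norm2_add_le[OF assms(1) ell2_scale[OF ell2_diff[OF it it]]])
    also have "norm2 (\<lambda>n. (\<i> / complex_of_real s) * (it (Suc k) n - it k n)) =
        (1 / s)\<^sup>2 * norm2 (\<lambda>n. it (Suc k) n - it k n)"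
      unfolding norm2_scale using s(1) by (simp add: norm_divide)
    also have "\<dots> \<le> (1 / s)\<^sup>2 * D"
    proof (rule mult_left_mono)
      have "q ^ k * D \<le> D" using q0 q1 D0 by (simp add: mult_left_le_one_le power_le_one)
      then show "norm2 (\<lambda>n. it (Suc k) n - it k n) \<le> D" using step[of k] by simp
    qed simp
    finally have "e\<^sup>2 * norm2 (it k) \<le> 2 * norm2 \<phi> + 2 * ((1 / s)\<^sup>2 * D)"
      using norm2_minus_scalar[OF it[of k], of z] unfolding e_def by simp
    then show ?thesis unfolding B_def using e by (simp add: pos_le_divide_eq mult.commute)
  qed
  then have \<psi>: "\<psi> \<in> ell2" using norm2_limit(1)[OF it _ lim] by blast
  moreover have "minus_scalar H z \<psi> n = \<phi> n" for n
  proof -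
    have "(\<lambda>k. minus_scalar H z (it k) n) \<longlonglongrightarrow> minus_scalar H z \<psi> n"
      unfolding minus_scalar_def H_def by (intro tendsto_intros lim)
    moreover have "(\<lambda>k. \<phi> n + (\<i> / complex_of_real s) * (it (Suc k) n - it k n)) \<longlonglongrightarrow>
        \<phi> n + (\<i> / complex_of_real s) * (\<psi> n - \<psi> n)"
      by (intro tendsto_intros lim LIMSEQ_Suc)
    ultimately show ?thesis
      unfolding res using LIMSEQ_unique by force
  qed
  ultimately show ?thesis by (intro bexI[of _ \<psi>]) auto
qed

lemma resolvent_in_ell2:
  assumes "\<phi> \<in> ell2" "Im z > 0"
  shows "resolvent H z \<phi> \<in> ell2" "minus_scalar H z (resolvent H z \<phi>) = \<phi>"
proof -
  have "inj_on (minus_scalar H z) ell2" using minus_scalar_inj assms(2) by simp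
  moreover have "\<phi> \<in> minus_scalar H z ` ell2" using minus_scalar_surj[OF assms] by auto
  ultimately show "resolvent H z \<phi> \<in> ell2" "minus_scalar H z (resolvent H z \<phi>) = \<phi>"
    unfolding resolvent_def by (rule the_inv_into_into[OF _ _ order.refl], rule f_the_inv_into_f)
qed

text \<open>
  The left-hand side is \<open>0\<close> if the spectral measure of \<open>\<phi>\<close> is zero, while the right-hand side is
  positive unless \<open>\<phi> = 0\<close>. So non-zero vectors have non-zero spectral measures.
\<close>
lemma Im_inner_resolvent:
  assumes "\<phi> \<in> ell2" "Im z > 0"
  shows "Im (ell2_inner \<phi> (resolvent H z \<phi>)) = Im z * norm2 (resolvent H z \<phi>)"
proof -
  define \<psi> where "\<psi> = resolvent H z \<phi>"
  have \<psi>: "\<psi> \<in> ell2" "minus_scalar H z \<psi> = \<phi>"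
    unfolding \<psi>_def using resolvent_in_ell2[OF assms] by auto
  have "((\<lambda>n. cnj (\<phi> n) * \<psi> n) has_sum ell2_inner \<phi> \<psi>) UNIV"
    unfolding ell2_inner_def using inner_summable[OF assms(1) \<psi>(1)] by simp
  then have "((\<lambda>n. Im (cnj (\<phi> n) * \<psi> n)) has_sum Im (ell2_inner \<phi> \<psi>)) UNIV"
    by (rule has_sum_Im)
  moreover have "Im (cnj (\<phi> n) * \<psi> n) = - Im (cnj (\<psi> n) * H \<psi> n) + Im z * (cmod (\<psi> n))\<^sup>2" for n
    unfolding \<psi>(2)[symmetric] minus_scalar_def cmod_power2
    by (simp add: power2_eq_square algebra_simps)
  moreover have "((\<lambda>n. - Im (cnj (\<psi> n) * H \<psi> n) + Im z * (cmod (\<psi> n))\<^sup>2) has_sum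
      (0 + Im z * norm2 \<psi>)) UNIV"
  proof (rule has_sum_add)
    show "((\<lambda>n. - Im (cnj (\<psi> n) * H \<psi> n)) has_sum 0) UNIV"
      unfolding has_sum_uminus using flux_sum[OF \<psi>(1)] by simp
    show "((\<lambda>n. Im z * (cmod (\<psi> n))\<^sup>2) has_sum (Im z * norm2 \<psi>)) UNIV"
      by (rule has_sum_cmult_right) (use \<psi>(1) in \<open>simp add: ell2_iff\<close>)
  qed
  ultimately show ?thesis
    unfolding \<psi>_def using has_sum_unique by fastforce
qed

text \<open>
  The integrand is bounded by \<open>1\<close>, equals \<open>1\<close> at \<open>E\<close> and tends to \<open>0\<close> at all other points.
\<close>
lemma atom_limit:
  fixes \<mu> :: "real measure"
  assumes "finite_measure \<mu>" "sets \<mu> = sets borel"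
  defines "e \<equiv> \<lambda>k. 1 / (real k + 1)"
  shows "(\<lambda>k. - \<i> * e k * (\<integral>t. 1 / (complex_of_real t - (E + \<i> * e k)) \<partial>\<mu>)) \<longlonglongrightarrow>
    complex_of_real (measure \<mu> {E})"
proof -
  interpret finite_measure \<mu> by fact
  let ?s = "\<lambda>k t. - \<i> * e k / (complex_of_real t - (E + \<i> * e k))"
  have e0: "e k > 0" for k unfolding e_def by simp
  have elim: "e \<longlonglongrightarrow> 0"
    unfolding e_def using LIMSEQ_inverse_real_of_nat by (simp add: inverse_eq_divide add.commute)
  have "(\<lambda>k. \<integral>t. ?s k t \<partial>\<mu>) \<longlonglongrightarrow> (\<integral>t. complex_of_real (indicator {E} t) \<partial>\<mu>)"
  proof (rule integral_dominated_convergence[where w = "\<lambda>_. 1"])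
    show "(\<lambda>t. complex_of_real (indicator {E} t)) \<in> borel_measurable \<mu>"
      using assms(2) by (simp cong: measurable_cong_sets)
    show "?s k \<in> borel_measurable \<mu>" for k
      using assms(2) by (simp cong: measurable_cong_sets)
    show "integrable \<mu> (\<lambda>_. 1::real)" by simp
    show "AE t in \<mu>. (\<lambda>k. ?s k t) \<longlonglongrightarrow> complex_of_real (indicator {E} t)"
    proof (rule AE_I2)
      fix t
      show "(\<lambda>k. ?s k t) \<longlonglongrightarrow> complex_of_real (indicator {E} t)"
      proof (cases "t = E")
        case True
        have "?s k t = 1" for k using e0[of k] True by simp
        then show ?thesis using True by simp
      next
        case False
        have "(\<lambda>k. ?s k t) \<longlonglongrightarrow> - \<i> * complex_of_real 0 / (complex_of_real t - (E + \<i> * complex_of_real 0))"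
          using False by (intro tendsto_intros elim) auto
        then show ?thesis using False by simp
      qed
    qed
    show "AE t in \<mu>. norm (?s k t) \<le> 1" for k
    proof (rule AE_I2)
      fix t
      have "\<bar>Im (complex_of_real t - (E + \<i> * e k))\<bar> \<le> cmod (complex_of_real t - (E + \<i> * e k))"
        by (rule abs_Im_le_cmod)
      then have "e k \<le> cmod (complex_of_real t - (E + \<i> * e k))" using e0[of k] by simp
      then show "norm (?s k t) \<le> 1"
        using e0[of k] by (simp add: norm_divide norm_mult divide_le_eq_1)
    qed
  qed
  moreover have "(\<integral>t. complex_of_real (indicator {E} t) \<partial>\<mu>) = complex_of_real (measure \<mu> {E})"
    using assms(2) by (simp add: sets_eq_imp_space_eq)
  moreover have "(\<integral>t. ?s k t \<partial>\<mu>) = - \<i> * e k * (\<integral>t. 1 / (complex_of_real t - (E + \<i> * e k)) \<partial>\<mu>)" for k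
    by (subst integral_mult_right_zero[symmetric]) simp
  ultimately show ?thesis by simp
qed

text \<open>
  The vectors \<open>\<psi> k\<close> are bounded by \<open>\<phi>\<close> and almost solve the eigenvalue equation:
  \<open>(H - E) (\<psi> k) = \<i> * e k * (\<psi> k - \<phi>)\<close>. So every pointwise limit solves it. By
  \<open>atom_limit\<close> the inner products with \<open>\<phi>\<close> tend to the mass of the atom, which keeps the limit
  away from \<open>0\<close>.
\<close>
lemma atom_eigenvector:
  assumes \<phi>: "\<phi> \<in> ell2" and sm: "has_spectral_measure H \<phi> \<mu>"
    and pos: "measure \<mu> {E} > 0"
  shows "\<exists>\<eta>\<in>ell2. \<eta> \<noteq> (\<lambda>_. 0) \<and> H \<eta> = (\<lambda>n. complex_of_real E * \<eta> n)"
proof -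
  define e where "e k = 1 / (real k + 1)" for k
  define z where "z k = complex_of_real E + \<i> * complex_of_real (e k)" for k
  define \<psi> where "\<psi> k = (\<lambda>n. (- \<i> * complex_of_real (e k)) * resolvent H (z k) \<phi> n)" for k
  have e0: "e k > 0" for k unfolding e_def by simp
  have elim: "e \<longlonglongrightarrow> 0"
    unfolding e_def using LIMSEQ_inverse_real_of_nat by (simp add: inverse_eq_divide add.commute)
  have z: "Im (z k) = e k" for k unfolding z_def by simp
  have R: "resolvent H (z k) \<phi> \<in> ell2" "minus_scalar H (z k) (resolvent H (z k) \<phi>) = \<phi>" for k
    using resolvent_in_ell2[OF \<phi>, of "z k"] z e0 by auto
  have \<psi>in: "\<psi> k \<in> ell2" for k unfolding \<psi>_def by (rule ell2_scale[OF R(1)])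
  have \<psi>norm: "norm2 (\<psi> k) \<le> norm2 \<phi>" for k
    using norm2_minus_scalar[OF R(1)[of k], of "z k"] unfolding R(2) z \<psi>_def norm2_scale
    by (simp add: norm_mult)
  have "cmod (\<psi> k n) \<le> sqrt (norm2 \<phi>)" for k n
    using cmod_le_norm2[OF \<psi>in[of k], of n] \<psi>norm[of k] by (intro real_le_rsqrt) simp
  then obtain r \<eta> where r: "strict_mono r" "\<And>n. (\<lambda>k. \<psi> (r k) n) \<longlonglongrightarrow> \<eta> n"
    using pointwise_convergent_subsequence[of \<psi> "sqrt (norm2 \<phi>)"] by blast
  have \<eta>: "\<eta> \<in> ell2" by (rule norm2_limit(1)[OF \<psi>in \<psi>norm r(2)])
  have inner: "ell2_inner \<phi> (\<psi> k) = - \<i> * e k * (\<integral>t. 1 / (complex_of_real t - (E + \<i> * e k)) \<partial>\<mu>)" for k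
  proof -
    have "ell2_inner \<phi> (\<psi> k) = - \<i> * e k * ell2_inner \<phi> (resolvent H (z k) \<phi>)"
      unfolding ell2_inner_def \<psi>_def infsum_cmult_right'[symmetric]
      by (simp only: mult.assoc mult.left_commute)
    then show ?thesis
      using sm z[of k] e0[of k] unfolding has_spectral_measure_def z_def by simp
  qed
  have "finite_measure \<mu>" "sets \<mu> = sets borel"
    using sm unfolding has_spectral_measure_def by auto
  then have "(\<lambda>k. ell2_inner \<phi> (\<psi> k)) \<longlonglongrightarrow> complex_of_real (measure \<mu> {E})"
    unfolding inner e_def by (rule atom_limit)
  from LIMSEQ_subseq_LIMSEQ[OF this r(1)]
  have lim: "(\<lambda>k. ell2_inner \<phi> (\<psi> (r k))) \<longlonglongrightarrow> complex_of_real (measure \<mu> {E})"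
    unfolding o_def .
  have "\<eta> \<noteq> (\<lambda>_. 0)"
  proof
    assume "\<eta> = (\<lambda>_. 0)"
    then have "(\<lambda>k. ell2_inner \<phi> (\<psi> (r k))) \<longlonglongrightarrow> 0"
      using r(2) inner_tendsto_0[OF \<phi>, of "\<lambda>k. \<psi> (r k)" "norm2 \<phi>"] \<psi>in \<psi>norm by simp
    from LIMSEQ_unique[OF lim this] show False using pos by simp
  qed
  moreover have "H \<eta> n = complex_of_real E * \<eta> n" for n
  proof -
    have eq: "H (\<psi> k) n - complex_of_real E * \<psi> k n = \<i> * e k * (\<psi> k n - \<phi> n)" for k
    proof -
      have "H (\<psi> k) n - z k * \<psi> k n = (- \<i> * e k) * minus_scalar H (z k) (resolvent H (z k) \<phi>) n"
        unfolding \<psi>_def H_scale minus_scalar_def by (simp add: algebra_simps)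
      then have "H (\<psi> k) n - z k * \<psi> k n = (- \<i> * e k) * \<phi> n" unfolding R(2) .
      then show ?thesis unfolding z_def by (simp add: algebra_simps)
    qed
    have "(\<lambda>k. H (\<psi> (r k)) n - complex_of_real E * \<psi> (r k) n) \<longlonglongrightarrow> H \<eta> n - complex_of_real E * \<eta> n"
      unfolding H_def by (intro tendsto_intros r(2))
    moreover have "(\<lambda>k. \<i> * complex_of_real (e (r k)) * (\<psi> (r k) n - \<phi> n)) \<longlonglongrightarrow>
        \<i> * complex_of_real 0 * (\<eta> n - \<phi> n)"
      using LIMSEQ_subseq_LIMSEQ[OF elim r(1)] by (intro tendsto_intros r(2)) (simp add: o_def)
    ultimately have "H \<eta> n - complex_of_real E * \<eta> n = \<i> * complex_of_real 0 * (\<eta> n - \<phi> n)"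
      unfolding eq by (rule LIMSEQ_unique)
    then show ?thesis by simp
  qed
  ultimately show ?thesis using \<eta> by (intro bexI[of _ \<eta>]) auto
qed

lemma pure_point_has_atom:
  assumes \<phi>: "\<phi> \<in> ell2" "\<phi> \<noteq> (\<lambda>_. 0)" and sm: "has_spectral_measure H \<phi> \<mu>"
    and pp: "pure_point \<mu>"
  shows "\<exists>E. measure \<mu> {E} > 0"
proof (rule ccontr)
  assume no: "\<not> (\<exists>E. measure \<mu> {E} > 0)"
  have fm: "finite_measure \<mu>" and sets: "sets \<mu> = sets borel"
    using sm unfolding has_spectral_measure_def by auto
  interpret finite_measure \<mu> by fact
  obtain C where C: "countable C" "emeasure \<mu> (UNIV - C) = 0"
    using pp unfolding pure_point_def by blast
  have "measure \<mu> {E} = 0" for E using no by (intro antisym) (auto simp: not_less)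
  then have "emeasure \<mu> {E} = 0" for E by (simp only: emeasure_eq_measure ennreal_0)
  then have pts: "{E} \<in> null_sets \<mu>" for E by (rule null_setsI) (simp add: sets)
  have "(\<Union>E\<in>C. {E}) \<in> null_sets \<mu>"
    by (rule null_sets_UN'[OF C(1)]) (rule pts)
  moreover have "UNIV - C \<in> null_sets \<mu>"
  proof -
    have "C \<in> sets borel" by (rule sets.countable[OF _ C(1)]) simp
    then have "UNIV - C \<in> sets \<mu>" unfolding sets by (rule sets.Diff[OF space_in_borel])
    with C(2) show ?thesis by (rule null_setsI)
  qed
  ultimately have "(\<Union>E\<in>C. {E}) \<union> (UNIV - C) \<in> null_sets \<mu>" by (rule null_sets.Un)
  moreover have "(\<Union>E\<in>C. {E}) \<union> (UNIV - C) = UNIV" by blast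
  ultimately have null: "UNIV \<in> null_sets \<mu>" by simp
  have "(\<integral>t. 1 / (complex_of_real t - \<i>) \<partial>\<mu>) = 0"
  proof (rule integral_eq_zero_AE)
    show "AE t in \<mu>. 1 / (complex_of_real t - \<i>) = 0"
      by (rule AE_I'[OF null]) simp
  qed
  then have "ell2_inner \<phi> (resolvent H \<i> \<phi>) = 0"
    using sm unfolding has_spectral_measure_def by simp
  then have "norm2 (resolvent H \<i> \<phi>) = 0"
    using Im_inner_resolvent[OF \<phi>(1), of \<i>] by simp
  then have "resolvent H \<i> \<phi> n = 0" for n
    using norm2_eq_0[OF resolvent_in_ell2(1)[OF \<phi>(1)], of \<i> n] by simp
  then have "resolvent H \<i> \<phi> = (\<lambda>_. 0)" by auto
  then have "\<phi> = (\<lambda>_. 0)"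
    using resolvent_in_ell2(2)[OF \<phi>(1), of \<i>] unfolding minus_scalar_def H_def by auto
  then show False using \<phi>(2) by simp
qed

text \<open>
  Without eigenvectors the pure point subspace is trivial, and on a trivial space \<open>H - z\<close> is
  invertible for all \<open>z\<close>.
\<close>
lemma pp_spectrum_empty:
  assumes "\<And>E u. u \<in> ell2 \<Longrightarrow> H u = (\<lambda>n. complex_of_real E * u n) \<Longrightarrow> u = (\<lambda>_. 0)"
  shows "pp_spectrum H = {}"
proof -
  have zero: "\<psi> = (\<lambda>_. 0)" if "\<psi> \<in> pp_subspace H" for \<psi>
    using that pure_point_has_atom atom_eigenvector assms unfolding pp_subspace_def by blast
  have H0: "minus_scalar H z (\<lambda>_. 0) = (\<lambda>_. 0)" for z
    by (simp add: minus_scalar_def H_def)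
  have M: "pp_subspace H = {} \<or> pp_subspace H = {\<lambda>_. 0}" using zero by blast
  have "bij_betw (minus_scalar H z) (pp_subspace H) (pp_subspace H)" for z
  proof -
    have "bij_betw (minus_scalar H z) {\<lambda>_. 0} {\<lambda>_. 0}"
      unfolding bij_betw_def using H0[of z] by simp
    then show ?thesis using M by (elim disjE) (simp_all add: bij_betw_def)
  qed
  moreover have "\<forall>\<psi>\<in>pp_subspace H. ell2_norm \<psi> \<le> 1 * ell2_norm (minus_scalar H z \<psi>)" for z
  proof
    fix \<psi> assume "\<psi> \<in> pp_subspace H"
    then have "\<psi> = (\<lambda>_. 0)" by (rule zero)
    then show "ell2_norm \<psi> \<le> 1 * ell2_norm (minus_scalar H z \<psi>)" by (simp add: H0)
  qed
  ultimately show ?thesis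
    unfolding pp_spectrum_def spectrum_on_def by blast
qed

end

section \<open>Cubes exclude eigenvalues\<close>

text \<open>
  The matrix depends on the potential in the block only, and not on the solution \<open>v\<close> or the place
  \<open>s\<close> of the block: this is what makes the same matrix reappear on the three blocks of a cube. It
  has determinant \<open>1\<close>, as a product of matrices with rows \<open>(w, -1)\<close> and \<open>(1, 0)\<close>.
\<close>
lemma transfer_matrix:
  fixes W :: "int \<Rightarrow> complex" and m :: int and p :: nat
  shows "\<exists>a b c d. a * d - b * c = 1 \<and>
    (\<forall>v s. (\<forall>i<p. v (s + int i + 1) = W (m + int i) * v (s + int i) - v (s + int i - 1)) \<longrightarrow>
       v (s + int p) = a * v s + b * v (s - 1) \<and> v (s + int p - 1) = c * v s + d * v (s - 1))"
proof (induction p)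
  case 0
  show ?case
    by (rule exI[of _ 1], rule exI[of _ 0], rule exI[of _ 0], rule exI[of _ 1]) simp
next
  case (Suc p)
  then obtain a b c d where det: "a * d - b * c = 1" and
    tr: "\<And>v s. (\<forall>i<p. v (s + int i + 1) = W (m + int i) * v (s + int i) - v (s + int i - 1)) \<Longrightarrow>
       v (s + int p) = a * v s + b * v (s - 1) \<and> v (s + int p - 1) = c * v s + d * v (s - 1)"
    by blast
  let ?w = "W (m + int p)"
  have "v (s + int (Suc p)) = (?w * a - c) * v s + (?w * b - d) * v (s - 1) \<and>
      v (s + int (Suc p) - 1) = a * v s + b * v (s - 1)"
    if rec: "\<forall>i<Suc p. v (s + int i + 1) = W (m + int i) * v (s + int i) - v (s + int i - 1)" for v s
  proof -
    have *: "v (s + int p) = a * v s + b * v (s - 1)" "v (s + int p - 1) = c * v s + d * v (s - 1)"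
      using tr[of v s] rec by auto
    have "v (s + int p + 1) = ?w * v (s + int p) - v (s + int p - 1)" using rec by blast
    then have "v (s + int (Suc p)) = ?w * v (s + int p) - v (s + int p - 1)" by (simp add: ac_simps)
    then show ?thesis unfolding * using *(1) by (simp add: algebra_simps)
  qed
  moreover have "(?w * a - c) * b - (?w * b - d) * a = 1" using det by (simp add: algebra_simps)
  ultimately show ?case by blast
qed

text \<open>
  Let \<open>\<tau>\<close> be the trace of the common transfer matrix. The Cayley-Hamilton theorem gives
  \<open>u (m + 2 p) = \<tau> * u (m + p) - u m\<close> and \<open>u (m + p) = \<tau> * u m - u (m - p)\<close>. The first
  equation bounds \<open>u m\<close> if \<open>\<bar>\<tau>\<bar> \<le> 1\<close>, the second one otherwise.
\<close>
lemma gordon_three_block: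
  fixes W u :: "int \<Rightarrow> complex" and p :: nat
  assumes rec: "\<And>n. u (n + 1) = W n * u n - u (n - 1)"
    and per: "\<And>n. m - int p \<le> n \<Longrightarrow> n < m + int p \<Longrightarrow> W (n + int p) = W n"
  shows "cmod (u m) \<le> cmod (u (m + int p)) + cmod (u (m + 2 * int p)) + cmod (u (m - int p))"
    and "cmod (u (m - 1)) \<le> cmod (u (m + int p - 1)) + cmod (u (m + 2 * int p - 1)) + cmod (u (m - int p - 1))"
proof -
  obtain a b c d where det: "a * d - b * c = 1" and
    tr: "\<And>v s. (\<forall>i<p. v (s + int i + 1) = W (m + int i) * v (s + int i) - v (s + int i - 1)) \<Longrightarrow>
       v (s + int p) = a * v s + b * v (s - 1) \<and> v (s + int p - 1) = c * v s + d * v (s - 1)"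
    using transfer_matrix[where W = W and m = m and p = p] by blast
  have step: "u (s + int p) = a * u s + b * u (s - 1)" "u (s + int p - 1) = c * u s + d * u (s - 1)"
    if "s \<in> {m - int p, m, m + int p}" for s
  proof -
    have "u (s + int i + 1) = W (m + int i) * u (s + int i) - u (s + int i - 1)" if "i < p" for i
    proof -
      have "W (s + int i) = W (m + int i)"
        using per[of "m - int p + int i"] per[of "m + int i"] \<open>i < p\<close> \<open>s \<in> _\<close>
        by (auto simp: algebra_simps)
      then show ?thesis using rec[of "s + int i"] by simp
    qed
    then show "u (s + int p) = a * u s + b * u (s - 1)" "u (s + int p - 1) = c * u s + d * u (s - 1)"
      using tr by auto
  qed
  let ?x = "\<lambda>j. u (m + j * int p)" and ?y = "\<lambda>j. u (m + j * int p - 1)"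
  have x: "u m = a * u (m - int p) + b * u (m - int p - 1)" "u (m - 1) = c * u (m - int p) + d * u (m - int p - 1)"
    "u (m + int p) = a * u m + b * u (m - 1)" "u (m + int p - 1) = c * u m + d * u (m - 1)"
    "u (m + 2 * int p) = a * u (m + int p) + b * u (m + int p - 1)"
    "u (m + 2 * int p - 1) = c * u (m + int p) + d * u (m + int p - 1)"
    using step[of "m - int p"] step[of m] step[of "m + int p"] by (simp_all add: algebra_simps)
  have cayley: "a * (a * x + b * y) + b * (c * x + d * y) = (a + d) * (a * x + b * y) - x"
    "c * (a * x + b * y) + d * (c * x + d * y) = (a + d) * (c * x + d * y) - y" for x y :: complex
    using det by algebra+
  have bound: "cmod x \<le> cmod x1 + cmod x2 + cmod x0"
    if "x2 = (a + d) * x1 - x" "x1 = (a + d) * x - x0" for x0 x x1 x2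
  proof (cases "cmod (a + d) \<le> 1")
    case True
    have "cmod x = cmod ((a + d) * x1 - x2)" using that(1) by simp
    also have "\<dots> \<le> cmod (a + d) * cmod x1 + cmod x2"
      using norm_triangle_ineq4[of "(a + d) * x1" x2] by (simp add: norm_mult)
    also have "\<dots> \<le> 1 * cmod x1 + cmod x2" using True by (intro add_right_mono mult_right_mono) auto
    finally show ?thesis using norm_ge_zero[of x0] by linarith
  next
    case False
    have "1 * cmod x \<le> cmod (a + d) * cmod x" using False by (intro mult_right_mono) auto
    also have "\<dots> = cmod (x1 + x0)" using that(2) by (simp add: norm_mult)
    also have "\<dots> \<le> cmod x1 + cmod x0" by (rule norm_triangle_ineq)
    finally show ?thesis using norm_ge_zero[of x2] by linarith
  qed
  show "cmod (u m) \<le> cmod (u (m + int p)) + cmod (u (m + 2 * int p)) + cmod (u (m - int p))"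
  proof (rule bound)
    show "u (m + 2 * int p) = (a + d) * u (m + int p) - u m"
      unfolding x(5) x(3,4) by (rule cayley)
    have "u (m + int p) = a * (a * u (m - int p) + b * u (m - int p - 1)) + b * (c * u (m - int p) + d * u (m - int p - 1))"
      using x(1,2,3) by simp
    also have "\<dots> = (a + d) * u m - u (m - int p)" unfolding cayley using x(1) by simp
    finally show "u (m + int p) = (a + d) * u m - u (m - int p)" .
  qed
  show "cmod (u (m - 1)) \<le> cmod (u (m + int p - 1)) + cmod (u (m + 2 * int p - 1)) + cmod (u (m - int p - 1))"
  proof (rule bound)
    show "u (m + 2 * int p - 1) = (a + d) * u (m + int p - 1) - u (m - 1)"
      unfolding x(6) x(3,4) by (rule cayley)
    have "u (m + int p - 1) = c * (a * u (m - int p) + b * u (m - int p - 1)) + d * (c * u (m - int p) + d * u (m - int p - 1))"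
      using x(1,2,4) by simp
    also have "\<dots> = (a + d) * u (m - 1) - u (m - int p - 1)" unfolding cayley using x(2) by simp
    finally show "u (m + int p - 1) = (a + d) * u (m - 1) - u (m - int p - 1)" .
  qed
qed

lemma recurrence_zero:
  fixes u W :: "int \<Rightarrow> complex"
  assumes rec: "\<And>n. u (n + 1) = W n * u n - u (n - 1)" and "u m = 0" "u (m - 1) = 0"
  shows "u n = 0"
proof -
  have up: "u (m + int k) = 0 \<and> u (m + int k - 1) = 0" for k
  proof (induction k)
    case (Suc k)
    then show ?case using rec[of "m + int k"] by (simp add: ac_simps)
  qed (use assms(2,3) in simp)
  have down: "u (m - int k) = 0 \<and> u (m - int k - 1) = 0" for k
  proof (induction k)
    case (Suc k)
    then show ?case using rec[of "m - int k - 1"] by (simp add: algebra_simps)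
  qed (use assms(2,3) in simp)
  show ?thesis
    using up[of "nat (n - m)"] down[of "nat (m - n)"] by (cases "m \<le> n") auto
qed

context schrodinger
begin

lemma no_eigenvalue:
  assumes cubes: "\<And>N. \<exists>p\<ge>N. \<forall>n. m - int p \<le> n \<longrightarrow> n < m + int p \<longrightarrow> V (n + int p) = V n"
    and u: "u \<in> ell2" "H u = (\<lambda>n. complex_of_real E * u n)"
  shows "u = (\<lambda>_. 0)"
proof -
  define W where "W n = complex_of_real (E - V n)" for n
  have rec: "u (n + 1) = W n * u n - u (n - 1)" for n
    using fun_cong[OF u(2), of n] unfolding H_def W_def by (simp add: algebra_simps)
  have small: "cmod (u m) \<le> 3 * e \<and> cmod (u (m - 1)) \<le> 3 * e" if e: "e > 0" for e
  proof -
    have "eventually (\<lambda>n. dist (u n) 0 < e) cofinite"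
      using ell2_tendsto_0[OF u(1)] e by (rule tendstoD)
    then have "finite {n. \<not> cmod (u n) < e}" by (simp add: eventually_cofinite)
    then obtain B where "abs ` {n. \<not> cmod (u n) < e} \<subseteq> {..B}"
      unfolding finite_int_iff_bounded_le by blast
    then have B: "\<not> cmod (u n) < e \<Longrightarrow> \<bar>n\<bar> \<le> B" for n by blast
    obtain p where p: "p \<ge> nat (B + \<bar>m\<bar> + 2)"
      "\<And>n. m - int p \<le> n \<Longrightarrow> n < m + int p \<Longrightarrow> V (n + int p) = V n"
      using cubes by blast
    have sm: "cmod (u n) \<le> e" if "\<bar>n\<bar> > B" for n using B[of n] that by force
    have "W (n + int p) = W n" if "m - int p \<le> n" "n < m + int p" for n
      unfolding W_def using p(2)[OF that] by simp
    note g = gordon_three_block[OF rec this]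
    have "cmod (u (m + int p)) \<le> e" "cmod (u (m + 2 * int p)) \<le> e" "cmod (u (m - int p)) \<le> e"
      "cmod (u (m + int p - 1)) \<le> e" "cmod (u (m + 2 * int p - 1)) \<le> e" "cmod (u (m - int p - 1)) \<le> e"
      using p(1) by (auto intro!: sm)
    then show ?thesis using g by fastforce
  qed
  have zero: "x = 0" if "\<And>e. e > 0 \<Longrightarrow> cmod x \<le> 3 * e" for x
  proof (rule ccontr)
    assume "x \<noteq> 0"
    then show False using that[of "cmod x / 6"] by simp
  qed
  have "u m = 0" "u (m - 1) = 0" by (rule zero, use small in blast)+
  then show ?thesis using recurrence_zero[where u = u and W = W, OF rec] by blast
qed

end

section \<open>Almost every Tribonacci potential\<close>

lemma shift_pow: "(shift ^^ j) x = (\<lambda>n. x (n + int j))"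
  by (induction j arbitrary: x) (auto simp: shift_def ac_simps)

definition cube_centred :: "nat \<Rightarrow> (int \<Rightarrow> nat) \<Rightarrow> bool" where
  "cube_centred p x \<longleftrightarrow> (\<forall>i\<in>{- int p..<int p}. x (i + int p) = x i)"

lemma cube_centred_measurable: "{x. cube_centred p x} \<in> sets borel"
proof -
  have "closed {x :: int \<Rightarrow> nat. x (i + int p) = x i}" for i
    by (intro closed_Collect_eq continuous_on_product_coordinates)
  then have "closed (\<Inter>i\<in>{- int p..<int p}. {x :: int \<Rightarrow> nat. x (i + int p) = x i})"
    by (intro closed_INT ballI)
  moreover have "{x. cube_centred p x} = (\<Inter>i\<in>{- int p..<int p}. {x :: int \<Rightarrow> nat. x (i + int p) = x i})"
    unfolding cube_centred_def by auto
  ultimately show ?thesis by (simp only: borel_closed)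
qed

text \<open>
  A word of period \<open>p\<close> and length \<open>3 p + q\<close> offers \<open>q\<close> consecutive sites that are centres of cubes,
  and \<open>q \<ge> p / 14\<close>. With one such word in each window of length \<open>31 p\<close>, the frequency is at least
  \<open>1 / (14 * 31) = 1 / 434\<close>.
\<close>
lemma cube_frequency:
  assumes "x \<in> tribonacci_subshift"
  shows "1 / 434 * real (31 * period n) \<le>
    real (card {j. j < 31 * period n \<and> cube_centred (period n) ((shift ^^ j) x)})"
proof -
  let ?p = "period n" and ?q = "excess n"
  let ?J = "{j. j < 31 * ?p \<and> cube_centred ?p ((shift ^^ j) x)}"
  obtain t where t: "0 \<le> t" "t + int (3 * ?p + ?q) \<le> int (31 * ?p)"
    and per: "\<And>j. t \<le> j \<Longrightarrow> j < t + int (2 * ?p + ?q) \<Longrightarrow> x (j + int ?p) = x j"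
    using tribonacci_cubes[OF assms, of 0 n] by auto
  have "(\<lambda>r. nat t + ?p + r) ` {..<?q} \<subseteq> ?J"
  proof
    fix j assume "j \<in> (\<lambda>r. nat t + ?p + r) ` {..<?q}"
    then obtain r where r: "j = nat t + ?p + r" "r < ?q" by auto
    have j: "int j = t + int ?p + int r" using r(1) t(1) by simp
    have "x (i + int ?p + int j) = x (i + int j)" if "- int ?p \<le> i" "i < int ?p" for i
      using per[of "i + int j"] that j r(2) by (simp add: ac_simps)
    then have "cube_centred ?p ((shift ^^ j) x)"
      unfolding cube_centred_def shift_pow by simp
    moreover have "j < 31 * ?p" using t(2) j r(2) by linarith
    ultimately show "j \<in> ?J" by blast
  qed
  then have "card ((\<lambda>r. nat t + ?p + r) ` {..<?q}) \<le> card ?J"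
    by (rule card_mono[rotated]) simp
  then have "?q \<le> card ?J" by (subst (asm) card_image) (auto simp: inj_on_def)
  then have "?p \<le> 14 * card ?J" using period_le_excess[of n] by linarith
  then show ?thesis by simp
qed

lemma pp_spectrum_empty_if_cubes:
  assumes x: "range x \<subseteq> letters" and cubes: "\<exists>\<^sub>\<infinity>n. cube_centred (period n) ((shift ^^ m) x)"
  shows "pp_spectrum (schrodinger_op f x) = {}"
proof -
  define K where "K = \<bar>f 1\<bar> + \<bar>f 2\<bar> + \<bar>f 3\<bar>"
  interpret schrodinger "\<lambda>n. f (x n)" K
  proof
    fix n
    have "x n \<in> letters" using x by blast
    then show "\<bar>f (x n)\<bar> \<le> K" unfolding K_def by auto
  qed
  have H: "schrodinger_op f x = H"
    by (rule ext) (simp add: schrodinger_op_def H_def)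
  have "\<exists>p\<ge>N. \<forall>n. int m - int p \<le> n \<longrightarrow> n < int m + int p \<longrightarrow> f (x (n + int p)) = f (x n)" for N
  proof -
    obtain k where k: "k \<ge> N" "cube_centred (period k) ((shift ^^ m) x)"
      using cubes unfolding INFM_nat_le by blast
    have "x (n + int (period k)) = x n" if "int m - int (period k) \<le> n" "n < int m + int (period k)" for n
    proof -
      have "n - int m \<in> {- int (period k)..<int (period k)}" using that by auto
      then have "x (n - int m + int (period k) + int m) = x (n - int m + int m)"
        using k(2) unfolding cube_centred_def shift_pow by blast
      then show ?thesis by (simp add: algebra_simps)
    qed
    then show ?thesis using k(1) period_ge[of k] by (intro exI[of _ "period k"]) auto
  qed
  then show ?thesis
    unfolding H using pp_spectrum_empty no_eigenvalue by blast
qed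

theorem corollary6p8:
  fixes f :: "nat \<Rightarrow> real" and \<nu> :: "(int \<Rightarrow> nat) measure"
  assumes "invariant_prob_measure tribonacci_subshift \<nu>"
    and "\<not> f constant_on alphabet 3"
  shows "AE x in \<nu>. pp_spectrum (schrodinger_op f x) = {}"
proof -
  let ?X = "tribonacci_subshift"
  interpret prob_space \<nu> using assms(1) unfolding invariant_prob_measure_def by blast
  have sets: "sets \<nu> = sets (restrict_space borel ?X)" and shift: "shift \<in> \<nu> \<rightarrow>\<^sub>M \<nu>"
    and inv: "distr \<nu> \<nu> shift = \<nu>"
    using assms(1) unfolding invariant_prob_measure_def by auto
  have space: "space \<nu> = ?X"
    using sets_eq_imp_space_eq[OF sets] by (simp add: space_restrict_space)
  define G where "G n = {x \<in> ?X. cube_centred (period n) x}" for n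
  have G: "G n \<in> sets \<nu>" for n
  proof -
    have "G n = ?X \<inter> {x. cube_centred (period n) x}" unfolding G_def by blast
    then show ?thesis
      unfolding sets sets_restrict_space using cube_centred_measurable by blast
  qed
  have shiftX: "(shift ^^ j) x \<in> ?X" if "x \<in> ?X" for x j
    using that measurable_space[OF shift] unfolding space by (induction j) auto
  have "AE x in \<nu>. \<exists>m. \<exists>\<^sub>\<infinity>n. (shift ^^ m) x \<in> G n"
  proof (rule AE_orbit_meets_limsup[OF shift inv G])
    fix n x assume "x \<in> space \<nu>"
    then have x: "x \<in> ?X" unfolding space .
    show "1 / 434 * real (31 * period n) \<le> real (card {j. j < 31 * period n \<and> (shift ^^ j) x \<in> G n})"
      using cube_frequency[OF x, of n] shiftX[OF x] unfolding G_def by simp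
  qed (use period_pos in auto)
  then show ?thesis
    using AE_space
  proof eventually_elim
    case (elim x)
    then obtain m where "\<exists>\<^sub>\<infinity>n. (shift ^^ m) x \<in> G n" by blast
    then have "\<exists>\<^sub>\<infinity>n. cube_centred (period n) ((shift ^^ m) x)"
      unfolding G_def by (simp add: INFM_mono)
    moreover have "range x \<subseteq> letters"
      using elim(2) unfolding space tribonacci_subshift_def AR_subshift_def two_sided_subshift_def alphabet_3
      by blast
    ultimately show ?case by (rule pp_spectrum_empty_if_cubes[rotated])
  qed
qed

end
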